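(* Let $\alpha$ be a fixed angle. Assume that the support function $p(\phi)$ of a hedgehog $\gamma$ is not a trigonometric polynomial, that is, its Fourier expansion contains infinitely many terms. Then the number of cusps of the iterated skew evolutes $\mathcal{E}_\alpha^n(\gamma)$ increases without bound as $n\to\infty$.
   Context: All functions are smooth. A hedgehog is a cooriented closed plane curve $\gamma$ given by a $2\pi$-periodic support function $p:\mathbb{R}/2\pi\mathbb{Z}\to\mathbb{R}$, where $p(\phi)$ is the signed distance from the origin to the tangent line of $\gamma$ whose coorienting normal is $(\cos\phi,\sin\phi)$; explicitly $\gamma(\phi)=(p(\phi)\cos\phi-p'(\phi)\sin\phi,\ p(\phi)\sin\phi+p'(\phi)\cos\phi)$. The (signed) curvature radius of $\gamma$ is $r(\phi)=p(\phi)+p''(\phi)$; the cusps of $\gamma$ occur where $r(\phi)=0$. For a fixed angle $\alpha$, the skew evolute $\mathcal{E}_\alpha(\gamma)$ is the envelope of the lines obtained by turning each tangent line of $\gamma$ through angle $\alpha$ about its tangency point. In terms of support functions, it is the hedgehog with support function $$q(\phi)=p(\phi-\alpha)\cos\alpha+p'(\phi-\alpha)\sin\alpha .$$ $\mathcal{E}_\alpha^n$ denotes the $n$-fold iterate of $\mathcal{E}_\alpha$; the iterated skew evolutes of $\gamma$ are the hedgehogs $\mathcal{E}_\alpha^n(\gamma)$.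
   Formalization: The angle α is assumed not to be an integer multiple of π; for such α the skew evolute only shifts the support function up to sign, so the number of cusps stays constant and the claim as written fails (e.g. α = 0). *)

theory Defs
  imports "HOL-Analysis.Analysis"
begin

definition smooth :: "(real \<Rightarrow> real) \<Rightarrow> bool" where
  "smooth f \<longleftrightarrow> (\<forall>k x. (deriv ^^ k) f differentiable (at x))"

(* A hedgehog is represented by its support function, a smooth function on the circle. *)

definition hedgehog :: "(real \<Rightarrow> real) \<Rightarrow> bool" where
  "hedgehog p \<longleftrightarrow> smooth p \<and> (\<forall>\<phi>. p (\<phi> + 2 * pi) = p \<phi>)"

definition normal_vec :: "real \<Rightarrow> real \<times> real" where
  "normal_vec \<phi> = (cos \<phi>, sin \<phi>)"

definition tangent_vec :: "real \<Rightarrow> real \<times> real" where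
  "tangent_vec \<phi> = (- sin \<phi>, cos \<phi>)"

definition curve :: "(real \<Rightarrow> real) \<Rightarrow> real \<Rightarrow> real \<times> real" where
  "curve p \<phi> = (p \<phi> * cos \<phi> - deriv p \<phi> * sin \<phi>, p \<phi> * sin \<phi> + deriv p \<phi> * cos \<phi>)"

definition curvature_radius :: "(real \<Rightarrow> real) \<Rightarrow> real \<Rightarrow> real" where
  "curvature_radius p \<phi> = p \<phi> + deriv (deriv p) \<phi>"

(* Cusps are recorded by their parameter, so [0, 2 pi) stands for the circle. *)

definition cusps :: "(real \<Rightarrow> real) \<Rightarrow> real set" where
  "cusps p = {\<phi> \<in> {0..<2 * pi}. curvature_radius p \<phi> = 0}"

(* The zero set of the curvature radius of a smooth hedgehog may be infinite, and card would
   then return 0. *)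

definition num_cusps :: "(real \<Rightarrow> real) \<Rightarrow> enat" where
  "num_cusps p = (if finite (cusps p) then enat (card (cusps p)) else \<infinity>)"

definition skew_evolute :: "real \<Rightarrow> (real \<Rightarrow> real) \<Rightarrow> real \<Rightarrow> real" where
  "skew_evolute \<alpha> p = (\<lambda>\<phi>. p (\<phi> - \<alpha>) * cos \<alpha> + deriv p (\<phi> - \<alpha>) * sin \<alpha>)"

definition trig_polynomial :: "(real \<Rightarrow> real) \<Rightarrow> bool" where
  "trig_polynomial f \<longleftrightarrow>
     (\<exists>N (a :: nat \<Rightarrow> real) (b :: nat \<Rightarrow> real).
        \<forall>x. f x = (\<Sum>k\<le>N. a k * cos (real k * x) + b k * sin (real k * x)))"

(* The line {x. normal_vec \<phi> \<bullet> x = p \<phi>} is the tangent line at curve p \<phi>,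
   and turning it by \<alpha> about that point gives the tangent line of the skew evolute with
   normal angle \<phi> + \<alpha>. *)

lemma support_line:
  "{x. normal_vec \<phi> \<bullet> x = normal_vec \<phi> \<bullet> a} = {a + t *\<^sub>R tangent_vec \<phi> | t. True}"
proof (intro set_eqI iffI)
  fix x assume "x \<in> {x. normal_vec \<phi> \<bullet> x = normal_vec \<phi> \<bullet> a}"
  then have e: "cos \<phi> * (fst x - fst a) = - (sin \<phi> * (snd x - snd a))"
    by (auto simp: normal_vec_def inner_prod_def algebra_simps)
  have sc: "sin \<phi> * sin \<phi> + cos \<phi> * cos \<phi> = 1"
    using sin_cos_squared_add3 by (simp add: add.commute)
  define t where "t = cos \<phi> * (snd x - snd a) - sin \<phi> * (fst x - fst a)"
  have "fst x - fst a = - (t * sin \<phi>)" "snd x - snd a = t * cos \<phi>"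
    using e sc unfolding t_def by algebra+
  then have "x = a + t *\<^sub>R tangent_vec \<phi>"
    by (simp add: tangent_vec_def prod_eq_iff)
  then show "x \<in> {a + t *\<^sub>R tangent_vec \<phi> | t. True}" by blast
next
  fix x assume "x \<in> {a + t *\<^sub>R tangent_vec \<phi> | t. True}"
  then show "x \<in> {x. normal_vec \<phi> \<bullet> x = normal_vec \<phi> \<bullet> a}"
    by (auto simp: normal_vec_def tangent_vec_def inner_prod_def algebra_simps)
qed

lemma normal_inner_curve: "normal_vec \<phi> \<bullet> curve p \<phi> = p \<phi>"
proof -
  have sc: "sin \<phi> * sin \<phi> + cos \<phi> * cos \<phi> = 1"
    using sin_cos_squared_add3 by (simp add: add.commute)
  have "cos \<phi> * (p \<phi> * cos \<phi> - deriv p \<phi> * sin \<phi>)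
      + sin \<phi> * (p \<phi> * sin \<phi> + deriv p \<phi> * cos \<phi>) = p \<phi>"
    using sc by algebra
  then show ?thesis by (simp add: normal_vec_def curve_def)
qed

lemma turned_line:
  "{curve p \<phi> + t *\<^sub>R tangent_vec (\<phi> + \<alpha>) | t. True} =
   {x. normal_vec (\<phi> + \<alpha>) \<bullet> x = skew_evolute \<alpha> p (\<phi> + \<alpha>)}"
proof -
  have sc: "sin \<phi> * sin \<phi> + cos \<phi> * cos \<phi> = 1"
    using sin_cos_squared_add3 by (simp add: add.commute)
  have "(cos \<phi> * cos \<alpha> - sin \<phi> * sin \<alpha>) * (p \<phi> * cos \<phi> - deriv p \<phi> * sin \<phi>)
      + (sin \<phi> * cos \<alpha> + cos \<phi> * sin \<alpha>) * (p \<phi> * sin \<phi> + deriv p \<phi> * cos \<phi>)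
      = p \<phi> * cos \<alpha> + deriv p \<phi> * sin \<alpha>"
    using sc by algebra
  then have "normal_vec (\<phi> + \<alpha>) \<bullet> curve p \<phi> = skew_evolute \<alpha> p (\<phi> + \<alpha>)"
    by (simp add: normal_vec_def curve_def skew_evolute_def cos_add sin_add)
  then show ?thesis using support_line[of "\<phi> + \<alpha>" "curve p \<phi>"] by simp
qed

lemma curve_velocity:
  assumes "smooth p"
  shows "(curve p has_vector_derivative curvature_radius p \<phi> *\<^sub>R tangent_vec \<phi>) (at \<phi>)"
proof -
  have "(deriv ^^ 0) p differentiable (at \<phi>)" "(deriv ^^ 1) p differentiable (at \<phi>)"
    using assms unfolding smooth_def by blast+
  then have d: "(p has_real_derivative deriv p \<phi>) (at \<phi>)"
    "(deriv p has_real_derivative deriv (deriv p) \<phi>) (at \<phi>)"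
    by (auto simp: DERIV_deriv_iff_real_differentiable)
  have "((\<lambda>\<phi>. p \<phi> * cos \<phi> - deriv p \<phi> * sin \<phi>) has_vector_derivative
      - (curvature_radius p \<phi> * sin \<phi>)) (at \<phi>)"
    unfolding has_real_derivative_iff_has_vector_derivative[symmetric] curvature_radius_def
    by (rule derivative_eq_intros d refl)+ (simp add: algebra_simps)
  moreover have "((\<lambda>\<phi>. p \<phi> * sin \<phi> + deriv p \<phi> * cos \<phi>) has_vector_derivative
      curvature_radius p \<phi> * cos \<phi>) (at \<phi>)"
    unfolding has_real_derivative_iff_has_vector_derivative[symmetric] curvature_radius_def
    by (rule derivative_eq_intros d refl)+ (simp add: algebra_simps)
  ultimately show ?thesis
    using has_vector_derivative_Pair by (fastforce simp: curve_def[abs_def] tangent_vec_def)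
qed

end

theory Submission
  imports Defs
begin

text \<open>Up to a rotation of the circle and the factor \<open>sin \<alpha>\<close>, the skew evolute acts on support functions,
  and hence on curvature radii, as the operator \<open>D + c\<close> with \<open>c = cot \<alpha>\<close>. The cusps of the \<open>n\<close>-th
  iterate are therefore, up to this rotation, the zeros of \<open>(D + c)\<^sup>n r\<close>, where \<open>r = p + p''\<close>. Since \<open>p\<close> is not a
  trigonometric polynomial, there are arbitrarily large \<open>m\<close> for which the \<open>m\<close>-th harmonic of \<open>r\<close>
  does not vanish, and it suffices to show that then \<open>(D + c)\<^sup>n r\<close> eventually has at least \<open>2m\<close>
  zeros.

  By Rolle's theorem applied to \<open>exp (a x) g x\<close>, the operator \<open>D + a\<close> never decreases the number of
  cyclic sign changes of a periodic function \<open>g\<close> (lemma \<open>alternates_damped_deriv\<close>). The same holds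
  for \<open>k\<^sup>2 - D\<^sup>2 = - (D - k) (D + k)\<close>, so its periodic inverse \<open>G\<close> never increases the number of sign
  changes, and it suffices to count the sign changes of \<open>G\<^sup>n\<^sup>+\<^sup>1 (D + c)\<^sup>n r\<close>.

  The point is to choose \<open>k\<close> such that \<open>G (D + c)\<close> amplifies the \<open>m\<close>-th harmonic more than all
  others. With \<open>W = c\<^sup>2 - D\<^sup>2\<close> and \<open>w = c\<^sup>2 + m\<^sup>2\<close>, which is the value of \<open>W\<close> on the \<open>m\<close>-th harmonic, put
  \<open>k\<^sup>2 = w + c\<^sup>2\<close>, so that \<open>k\<^sup>2 - D\<^sup>2 = w + W\<close>. The inequality \<open>w + t \<ge> 2 sqrt (w t)\<close>, with equality
  only for \<open>t = w\<close>, becomes the energy identity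
  \<open>\<parallel>(w + W) u\<parallel>\<^sup>2 = 4 w \<parallel>(D + c) u\<parallel>\<^sup>2 + \<parallel>(m\<^sup>2 + D\<^sup>2) u\<parallel>\<^sup>2\<close>
  (lemma \<open>energy_identity\<close>). Applied along the iteration and rescaled by powers of \<open>4 w\<close>, it gives a
  decreasing energy whose decrements are the defects \<open>\<parallel>(m\<^sup>2 + D\<^sup>2) u\<^sub>n\<parallel>\<^sup>2\<close>, so the rescaled defects tend
  to zero, while the rescaled \<open>m\<close>-th harmonic has constant size. A function that almost solves
  \<open>u'' + m\<^sup>2 u = 0\<close> is uniformly close to \<open>R cos (m x - \<theta>)\<close>; if its \<open>m\<close>-th harmonic is large compared
  to the defect, it inherits the \<open>2m\<close> sign changes of this cosine (lemma
  \<open>alternates_if_dominant_mode\<close>). The required large \<open>m\<close> exist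
  because Fourier coefficients determine a continuous periodic function.\<close>

section \<open>Smooth periodic functions and first-order operators\<close>

lemma smooth_DERIV:
  assumes "smooth f"
  shows "(f has_real_derivative deriv f x) (at x)"
proof -
  have "(deriv ^^ 0) f differentiable (at x)"
    using assms unfolding smooth_def by blast
  then show ?thesis by (simp add: DERIV_deriv_iff_real_differentiable)
qed

lemma smooth_deriv: "smooth f \<Longrightarrow> smooth (deriv f)"
  unfolding smooth_def by (metis comp_apply funpow_Suc_right)

lemma smooth_continuous: "smooth f \<Longrightarrow> continuous_on A f"
  by (meson DERIV_continuous_on has_field_derivative_at_within smooth_DERIV)

text \<open>Smoothness is proved by exhibiting a class of functions closed under differentiation; this avoids
  computing higher derivatives.\<close>

lemma smooth_coinduct:
  assumes "f \<in> X"
    and step: "\<And>f. f \<in> X \<Longrightarrow> \<exists>f' \<in> X. \<forall>x. (f has_real_derivative f' x) (at x)"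
  shows "smooth f"
proof -
  have "(deriv ^^ k) f \<in> X" for k
  proof (induction k)
    case 0
    then show ?case using assms(1) by simp
  next
    case (Suc k)
    then obtain f' where f': "f' \<in> X" "\<forall>x. ((deriv ^^ k) f has_real_derivative f' x) (at x)"
      using step by blast
    then have "deriv ((deriv ^^ k) f) = f'"
      by (intro ext) (simp add: DERIV_imp_deriv)
    then show ?case using f' by simp
  qed
  then show ?thesis
    unfolding smooth_def using step real_differentiable_def by blast
qed

lemma smooth_linear_combination:
  assumes "smooth f" "smooth g"
  shows "smooth (\<lambda>x. a * f x + b * g x)"
proof (rule smooth_coinduct)
  let ?X = "{\<lambda>x. a * f x + b * g x | f g. smooth f \<and> smooth g}"
  show "(\<lambda>x. a * f x + b * g x) \<in> ?X" using assms by blast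
  fix h assume "h \<in> ?X"
  then obtain f g where h: "h = (\<lambda>x. a * f x + b * g x)" and s: "smooth f" "smooth g"
    by blast
  have "(h has_real_derivative a * deriv f x + b * deriv g x) (at x)" for x
    unfolding h by (rule derivative_eq_intros smooth_DERIV s refl | simp)+
  moreover have "(\<lambda>x. a * deriv f x + b * deriv g x) \<in> ?X"
    using s smooth_deriv by blast
  ultimately show "\<exists>f'\<in>?X. \<forall>x. (h has_real_derivative f' x) (at x)"
    by (intro bexI[of _ "\<lambda>x. a * deriv f x + b * deriv g x"]) auto
qed

lemma hedgehog_smooth: "hedgehog f \<Longrightarrow> smooth f"
  by (simp add: hedgehog_def)

lemma hedgehog_periodic: "hedgehog f \<Longrightarrow> f (x + 2 * pi) = f x"
  by (simp add: hedgehog_def)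

lemmas hedgehog_DERIV = smooth_DERIV[OF hedgehog_smooth]
lemmas hedgehog_continuous = smooth_continuous[OF hedgehog_smooth]

lemma hedgehog_linear_combination:
  "hedgehog f \<Longrightarrow> hedgehog g \<Longrightarrow> hedgehog (\<lambda>x. a * f x + b * g x)"
  by (simp add: hedgehog_def smooth_linear_combination)

lemma hedgehog_deriv:
  assumes "hedgehog f"
  shows "hedgehog (deriv f)"
proof -
  have "deriv f (x + 2 * pi) = deriv f x" for x
  proof -
    have "((\<lambda>x. f (x + 2 * pi)) has_real_derivative deriv f (x + 2 * pi)) (at x)"
      using hedgehog_DERIV[OF assms] DERIV_shift by blast
    then have "(f has_real_derivative deriv f (x + 2 * pi)) (at x)"
      by (simp add: hedgehog_periodic[OF assms])
    then show ?thesis by (metis DERIV_imp_deriv)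
  qed
  then show ?thesis
    using assms smooth_deriv by (simp add: hedgehog_def)
qed

lemma deriv_linear_combination:
  assumes "smooth f" "smooth g"
  shows "deriv (\<lambda>x. a * f x + b * g x) = (\<lambda>x. a * deriv f x + b * deriv g x)"
proof
  fix x
  show "deriv (\<lambda>x. a * f x + b * g x) x = a * deriv f x + b * deriv g x"
    by (rule DERIV_imp_deriv) (rule derivative_eq_intros smooth_DERIV assms refl | simp)+
qed

text \<open>With \<open>a = cot \<alpha>\<close> this is the skew evolute operator, freed from its rotation and its factor
  \<open>sin \<alpha>\<close>.\<close>

definition damped_deriv :: "real \<Rightarrow> (real \<Rightarrow> real) \<Rightarrow> real \<Rightarrow> real" where
  "damped_deriv a f = (\<lambda>x. a * f x + deriv f x)"

lemma hedgehog_damped_deriv: "hedgehog f \<Longrightarrow> hedgehog (damped_deriv a f)"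
  unfolding damped_deriv_def
  using hedgehog_linear_combination[of f "deriv f" a 1] hedgehog_deriv by simp

lemma hedgehog_damped_deriv_funpow: "hedgehog f \<Longrightarrow> hedgehog ((damped_deriv a ^^ n) f)"
  by (induction n) (auto intro: hedgehog_damped_deriv)

lemma deriv_damped_deriv:
  "hedgehog f \<Longrightarrow> deriv (damped_deriv a f) = damped_deriv a (deriv f)"
  unfolding damped_deriv_def
  using deriv_linear_combination[of f "deriv f" a 1]
  by (simp add: hedgehog_smooth hedgehog_deriv)

lemma damped_deriv_linear_combination:
  assumes "hedgehog f" "hedgehog g"
  shows "damped_deriv a (\<lambda>x. s * f x + t * g x) =
    (\<lambda>x. s * damped_deriv a f x + t * damped_deriv a g x)"
  unfolding damped_deriv_def
  by (simp add: deriv_linear_combination assms hedgehog_smooth algebra_simps)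

text \<open>The periodic solution of \<open>g' + a g = f\<close> is a multiple of the average of \<open>f\<close> over one period with an
  exponential weight. Both its periodicity and its derivative are visible from this formula.\<close>

lemma damped_deriv_surj:
  assumes f: "hedgehog f" and a: "a \<noteq> 0"
  obtains g where "hedgehog g" "damped_deriv a g = f"
proof -
  define K where "K = 1 / (exp (2 * pi * a) - 1)"
  define g where "g x = K * integral {0..2*pi} (\<lambda>s. exp (a * s) * f (x + s))" for x
  have nz: "exp (2 * pi * a) - 1 \<noteq> 0" using a by simp
  note c[continuous_intros] = continuous_on_compose2[OF hedgehog_continuous[OF f, of UNIV]]
    continuous_on_compose2[OF hedgehog_continuous[OF hedgehog_deriv[OF f], of UNIV]]
  \<comment> \<open>Integration by parts moves the derivative from \<open>f\<close> to the weight.\<close>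
  have parts: "integral {0..2*pi} (\<lambda>s. exp (a * s) * deriv f (x + s)) =
      (exp (2 * pi * a) - 1) * f x - a * integral {0..2*pi} (\<lambda>s. exp (a * s) * f (x + s))" for x
  proof -
    have d: "((\<lambda>s. exp (a * s) * f (x + s)) has_real_derivative
        exp (a * s) * deriv f (x + s) + a * (exp (a * s) * f (x + s))) (at s)" for s
    proof -
      have "((\<lambda>s. f (s + x)) has_real_derivative deriv f (s + x)) (at s)"
        using hedgehog_DERIV[OF f] DERIV_shift by blast
      then have d: "((\<lambda>s. f (x + s)) has_real_derivative deriv f (x + s)) (at s)"
        by (simp add: add.commute)
      show ?thesis by (rule derivative_eq_intros d refl | simp)+
    qed
    have "((\<lambda>s. exp (a * s) * deriv f (x + s) + a * (exp (a * s) * f (x + s)))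
      has_integral exp (a * (2*pi)) * f (x + 2*pi) - exp (a * 0) * f (x + 0)) {0..2*pi}"
      by (rule fundamental_theorem_of_calculus)
        (auto intro: d has_field_derivative_at_within
          simp: has_real_derivative_iff_has_vector_derivative[symmetric])
    then have "((\<lambda>s. exp (a * s) * deriv f (x + s) + a * (exp (a * s) * f (x + s)))
      has_integral (exp (2 * pi * a) - 1) * f x) {0..2*pi}"
      by (simp only: hedgehog_periodic[OF f]) (simp add: algebra_simps)
    then have "integral {0..2*pi} (\<lambda>s. exp (a * s) * deriv f (x + s) + a * (exp (a * s) * f (x + s)))
      = (exp (2 * pi * a) - 1) * f x" by (rule integral_unique)
    moreover have "integral {0..2*pi} (\<lambda>s. exp (a * s) * deriv f (x + s) + a * (exp (a * s) * f (x + s)))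
       = integral {0..2*pi} (\<lambda>s. exp (a * s) * deriv f (x + s)) +
         integral {0..2*pi} (\<lambda>s. a * (exp (a * s) * f (x + s)))"
      by (rule integral_add) (auto intro!: integrable_continuous_interval continuous_intros)
    ultimately show ?thesis by simp
  qed
  have D: "(g has_real_derivative f x - a * g x) (at x)" for x
  proof -
    have "((\<lambda>x. integral (cbox 0 (2*pi)) (\<lambda>s. exp (a * s) * f (x + s))) has_real_derivative
        integral (cbox 0 (2*pi)) (\<lambda>s. exp (a * s) * deriv f (x + s))) (at x within UNIV)"
    proof (rule leibniz_rule_field_derivative)
      fix x t :: real
      have d: "((\<lambda>x. f (x + t)) has_real_derivative deriv f (x + t)) (at x)"
        using hedgehog_DERIV[OF f] DERIV_shift by blast
      show "((\<lambda>x. exp (a * t) * f (x + t)) has_real_derivative exp (a * t) * deriv f (x + t)) (at x)"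
        by (rule derivative_eq_intros d refl | simp)+
      show "(\<lambda>s. exp (a * s) * f (x + s)) integrable_on cbox 0 (2 * pi)"
        by (auto intro!: integrable_continuous_interval continuous_intros)
    next
      show "continuous_on (UNIV \<times> cbox 0 (2 * pi)) (\<lambda>(x, t). exp (a * t) * deriv f (x + t))"
        by (auto simp: case_prod_beta intro!: continuous_intros)
    qed auto
    then have "((\<lambda>x. integral {0..2*pi} (\<lambda>s. exp (a * s) * f (x + s))) has_real_derivative
        (exp (2 * pi * a) - 1) * f x - a * integral {0..2*pi} (\<lambda>s. exp (a * s) * f (x + s))) (at x)"
      by (simp add: parts)
    then have "(g has_real_derivative K * ((exp (2 * pi * a) - 1) * f x
         - a * integral {0..2*pi} (\<lambda>s. exp (a * s) * f (x + s)))) (at x)"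
      unfolding g_def by (rule DERIV_cmult)
    moreover have "K * ((exp (2 * pi * a) - 1) * f x
         - a * integral {0..2*pi} (\<lambda>s. exp (a * s) * f (x + s))) = f x - a * g x"
      using nz by (simp add: g_def K_def field_simps)
    ultimately show ?thesis by simp
  qed
  have "smooth g"
  proof (rule smooth_coinduct)
    \<comment> \<open>Since \<open>g' = f - a g\<close>, this class is closed under differentiation.\<close>
    let ?X = "{\<lambda>x. b * g x + h x | b h. smooth h}"
    have "smooth (\<lambda>x. 0 * f x + 0 * f x)"
      using f hedgehog_smooth smooth_linear_combination by blast
    then show "g \<in> ?X" by (intro CollectI exI[of _ 1] exI conjI) (auto simp: fun_eq_iff)
    fix u assume "u \<in> ?X"
    then obtain b h where u: "u = (\<lambda>x. b * g x + h x)" and h: "smooth h" by blast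
    have "(u has_real_derivative (- b * a) * g x + (b * f x + 1 * deriv h x)) (at x)" for x
      unfolding u by (rule derivative_eq_intros D smooth_DERIV h refl | simp add: algebra_simps)+
    moreover have "smooth (\<lambda>x. b * f x + 1 * deriv h x)"
      using f h hedgehog_smooth smooth_deriv smooth_linear_combination by blast
    then have "(\<lambda>x. (- b * a) * g x + (b * f x + 1 * deriv h x)) \<in> ?X"
      by (intro CollectI exI[of _ "- b * a"] exI[of _ "\<lambda>x. b * f x + 1 * deriv h x"] conjI refl)
    ultimately show "\<exists>f'\<in>?X. \<forall>x. (u has_real_derivative f' x) (at x)"
      by (intro bexI[of _ "\<lambda>x. (- b * a) * g x + (b * f x + 1 * deriv h x)"] allI)
  qed
  moreover have "g (x + 2 * pi) = g x" for x
  proof -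
    have "f (x + 2 * pi + s) = f (x + s)" for s
      using hedgehog_periodic[OF f, of "x + s"] by (simp add: add_ac)
    then show ?thesis by (simp add: g_def)
  qed
  ultimately have "hedgehog g" by (simp add: hedgehog_def)
  moreover have "damped_deriv a g = f"
    by (auto simp: damped_deriv_def DERIV_imp_deriv[OF D])
  ultimately show ?thesis by (rule that)
qed

section \<open>Cyclic sign changes\<close>

text \<open>Sign changes are counted cyclically: the last point is the first one shifted by a full period, so
  for a periodic function the sign pattern closes up around the circle.\<close>

definition alternates :: "nat \<Rightarrow> (real \<Rightarrow> real) \<Rightarrow> bool" where
  "alternates N f \<longleftrightarrow> (\<exists>x :: nat \<Rightarrow> real.
     (\<forall>i<N. x i < x (Suc i) \<and> f (x i) * f (x (Suc i)) < 0) \<and> x N = x 0 + 2 * pi)"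

text \<open>Between two consecutive points, \<open>exp (a x) g x\<close> changes sign, so somewhere its derivative
  \<open>exp (a x) (g' x + a g x)\<close> has the sign of the right endpoint. Hence the new values alternate as
  the right endpoints do.\<close>

lemma alternates_damped_deriv:
  assumes g: "hedgehog g" and alt: "alternates N g"
  shows "alternates N (damped_deriv a g)"
proof (cases "N = 0")
  case True
  then show ?thesis using alt by (simp add: alternates_def)
next
  case False
  obtain x where x: "\<And>i. i < N \<Longrightarrow> x i < x (Suc i)"
      "\<And>i. i < N \<Longrightarrow> g (x i) * g (x (Suc i)) < 0" "x N = x 0 + 2 * pi"
    using alt unfolding alternates_def by blast
  let ?f = "damped_deriv a g"
  have f: "hedgehog ?f" using g by (rule hedgehog_damped_deriv)
  have "\<exists>y. x i < y \<and> y < x (Suc i) \<and> 0 < ?f y * g (x (Suc i))" if i: "i < N" for i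
  proof -
    have "((\<lambda>x. exp (a * x) * g x) has_real_derivative exp (a * y) * ?f y) (at y)" for y
      unfolding damped_deriv_def
      by (rule derivative_eq_intros hedgehog_DERIV g refl | simp add: algebra_simps)+
    from MVT2[OF x(1)[OF i] this] obtain y where y: "x i < y" "y < x (Suc i)"
      and e: "exp (a * x (Suc i)) * g (x (Suc i)) - exp (a * x i) * g (x i) =
          (x (Suc i) - x i) * (exp (a * y) * ?f y)" by blast
    have "exp (a * x i) * (g (x i) * g (x (Suc i))) < 0"
      using x(2)[OF i] by (simp add: mult_less_0_iff)
    moreover have "0 \<le> exp (a * x (Suc i)) * (g (x (Suc i)) * g (x (Suc i)))" by simp
    ultimately have "0 < (exp (a * x (Suc i)) * g (x (Suc i)) - exp (a * x i) * g (x i)) * g (x (Suc i))"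
      by (simp add: algebra_simps)
    also have "\<dots> = ((x (Suc i) - x i) * exp (a * y)) * (?f y * g (x (Suc i)))"
      unfolding e by simp
    finally have "0 < ((x (Suc i) - x i) * exp (a * y)) * (?f y * g (x (Suc i)))" .
    moreover have "0 < (x (Suc i) - x i) * exp (a * y)" using x(1)[OF i] by simp
    ultimately have "0 < ?f y * g (x (Suc i))" by (rule zero_less_mult_pos)
    then show ?thesis using y by blast
  qed
  then obtain y0 where y0: "\<And>i. i < N \<Longrightarrow> x i < y0 i \<and> y0 i < x (Suc i) \<and> 0 < ?f (y0 i) * g (x (Suc i))"
    by metis
  define y where "y i = (if i < N then y0 i else y0 0 + 2 * pi)" for i
  \<comment> \<open>Two numbers with the signs of alternating values have opposite signs.\<close>
  have sgn: "u * v < 0" if "0 < u * s" "0 < v * t" "s * t < 0" for u v s t :: real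
    using that by (auto simp: mult_less_0_iff zero_less_mult_iff)
  have "y i < y (Suc i) \<and> ?f (y i) * ?f (y (Suc i)) < 0" if i: "i < N" for i
  proof (cases "Suc i < N")
    case True
    then show ?thesis
      using y0[OF i] y0[OF True] x(2)[OF True] sgn by (auto simp: y_def i)
  next
    case F: False
    then have N: "N = Suc i" using i by simp
    \<comment> \<open>The pattern closes up: the right endpoint of the last interval is the first point one period later.\<close>
    have "g (x N) = g (x 0)" by (simp add: x(3) hedgehog_periodic[OF g])
    then have "?f (y0 i) * ?f (y0 0) < 0"
      using sgn y0[OF i] y0[of 0] x(2)[of 0] N by auto
    then show ?thesis
      using y0[OF i] y0[of 0] x(3) N by (auto simp: y_def hedgehog_periodic[OF f])
  qed
  moreover have "y N = y 0 + 2 * pi" using False by (simp add: y_def)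
  ultimately show ?thesis unfolding alternates_def by blast
qed

lemma alternates_scaled_shift:
  assumes "alternates N f" "s \<noteq> 0"
  shows "alternates N (\<lambda>x. s * f (x - b))"
proof -
  obtain x where x: "\<And>i. i < N \<Longrightarrow> x i < x (Suc i)"
      "\<And>i. i < N \<Longrightarrow> f (x i) * f (x (Suc i)) < 0" "x N = x 0 + 2 * pi"
    using assms(1) unfolding alternates_def by blast
  have "(s * f (x i)) * (s * f (x (Suc i))) < 0" if "i < N" for i
  proof -
    have "0 < s * s" using assms(2) by (auto simp: zero_less_mult_iff)
    then have "(s * s) * (f (x i) * f (x (Suc i))) < 0"
      using x(2)[OF that] by (rule mult_pos_neg)
    then show ?thesis by (simp add: mult_ac)
  qed
  then show ?thesis
    unfolding alternates_def using x by (intro exI[of _ "\<lambda>i. x i + b"]) auto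
qed

lemma IVT_sign_change:
  fixes f :: "real \<Rightarrow> real"
  assumes "continuous_on {a..b} f" "a < b" "f a * f b < 0"
  shows "\<exists>z. a < z \<and> z < b \<and> f z = 0"
proof -
  have "\<exists>z\<ge>a. z \<le> b \<and> f z = 0"
  proof (cases "f a < 0")
    case True
    then show ?thesis using assms by (intro IVT') (auto simp: mult_less_0_iff)
  next
    case False
    then show ?thesis using assms by (intro IVT2') (auto simp: mult_less_0_iff)
  qed
  then show ?thesis using assms by (metis less_le mult_zero_left mult_zero_right)
qed

lemma periodic_shift_int:
  fixes f :: "real \<Rightarrow> 'a"
  assumes "\<And>x. f (x + 2 * pi) = f x"
  shows "f (x + 2 * pi * of_int k) = f x"
proof -
  have n: "f (x + 2 * pi * real n) = f x" for n x
  proof (induction n)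
    case (Suc n)
    have "f (x + 2 * pi * real (Suc n)) = f ((x + 2 * pi * real n) + 2 * pi)"
      by (simp add: algebra_simps)
    then show ?case using Suc assms by simp
  qed simp
  show ?thesis
  proof (cases "0 \<le> k")
    case True
    then show ?thesis using n[of x "nat k"] by simp
  next
    case False
    then show ?thesis using n[of "x + 2 * pi * of_int k" "nat (-k)"] by simp
  qed
qed

lemma periodic_all:
  fixes f :: "real \<Rightarrow> 'a"
  assumes per: "\<And>x. f (x + 2 * pi) = f x" and "\<And>x. x \<in> {0..2*pi} \<Longrightarrow> P (f x)"
  shows "P (f x)"
proof -
  have "of_int \<lfloor>x / (2 * pi)\<rfloor> * (2 * pi) \<le> x" "x < (of_int \<lfloor>x / (2 * pi)\<rfloor> + 1) * (2 * pi)"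
    using floor_divide_lower[of "2 * pi" x] floor_divide_upper[of "2 * pi" x] by auto
  then have "P (f (x + 2 * pi * of_int (- \<lfloor>x / (2 * pi)\<rfloor>)))"
    by (intro assms(2)) (simp add: algebra_simps)
  also have "f (x + 2 * pi * of_int (- \<lfloor>x / (2 * pi)\<rfloor>)) = f x"
    by (rule periodic_shift_int) (rule per)
  finally show ?thesis .
qed

text \<open>Each sign change contributes a zero. The zeros lie in an open interval of length \<open>2\<pi>\<close>, so they stay
  distinct when they are reduced to \<open>[0, 2\<pi>)\<close>.\<close>

lemma num_cusps_ge_alternations:
  assumes cont: "continuous_on UNIV (curvature_radius p)"
    and per: "\<And>x. curvature_radius p (x + 2 * pi) = curvature_radius p x"
    and alt: "alternates N (curvature_radius p)"
  shows "enat N \<le> num_cusps p"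
proof (cases "finite (cusps p)")
  case False
  then show ?thesis by (simp add: num_cusps_def)
next
  case True
  let ?f = "curvature_radius p"
  obtain x where x: "\<And>i. i < N \<Longrightarrow> x i < x (Suc i)"
      "\<And>i. i < N \<Longrightarrow> ?f (x i) * ?f (x (Suc i)) < 0" "x N = x 0 + 2 * pi"
    using alt unfolding alternates_def by blast
  have "\<exists>z. x i < z \<and> z < x (Suc i) \<and> ?f z = 0" if "i < N" for i
    using x(1,2)[OF that] continuous_on_subset[OF cont] by (intro IVT_sign_change) auto
  then obtain z where z: "\<And>i. i < N \<Longrightarrow> x i < z i \<and> z i < x (Suc i) \<and> ?f (z i) = 0"
    by metis
  have mono: "x i \<le> x j" if "i \<le> j" "j \<le> N" for i j
    using that(2,1)
  proof (induction j)
    case (Suc j)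
    then show ?case using x(1)[of j] by (cases "i = Suc j") auto
  qed simp
  have zless: "z i < z j" if "i < j" "j < N" for i j
    using z[of i] z[of j] mono[of "Suc i" j] that by auto
  have zrange: "x 0 < z i \<and> z i < x 0 + 2 * pi" if "i < N" for i
    using z[OF that] mono[of 0 i] mono[of "Suc i" N] x(3) that by auto
  define w where "w i = z i + 2 * pi * of_int (- \<lfloor>z i / (2 * pi)\<rfloor>)" for i
  have "w i \<in> cusps p" if "i < N" for i
  proof -
    have "?f (w i) = 0"
      unfolding w_def using z[OF that] periodic_shift_int[of ?f, OF per] by metis
    moreover have "of_int \<lfloor>z i / (2 * pi)\<rfloor> * (2 * pi) \<le> z i"
      "z i < (of_int \<lfloor>z i / (2 * pi)\<rfloor> + 1) * (2 * pi)"
      using floor_divide_lower[of "2 * pi" "z i"] floor_divide_upper[of "2 * pi" "z i"] by auto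
    ultimately show ?thesis
      by (auto simp: cusps_def w_def algebra_simps)
  qed
  moreover have "inj_on w {..<N}"
  proof (rule linorder_inj_onI)
    fix i j assume ij: "i < j" "i \<in> {..<N}" "j \<in> {..<N}"
    show "w i \<noteq> w j"
    proof
      assume "w i = w j"
      then have e: "z j - z i = 2 * pi * of_int (\<lfloor>z j / (2 * pi)\<rfloor> - \<lfloor>z i / (2 * pi)\<rfloor>)"
        by (simp add: w_def algebra_simps)
      let ?k = "\<lfloor>z j / (2 * pi)\<rfloor> - \<lfloor>z i / (2 * pi)\<rfloor>"
      have "0 < z j - z i" "z j - z i < 2 * pi"
        using zless zrange[of i] zrange[of j] ij by auto
      then have "0 < of_int ?k * (2 * pi)" "of_int ?k * (2 * pi) < 1 * (2 * pi)"
        unfolding e by (simp_all only: mult.commute mult_1_right)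
      moreover have False if "0 < of_int k * (2 * pi)" "of_int k * (2 * pi) < 1 * (2 * pi)" for k
      proof -
        have "0 < (of_int k :: real)" "(of_int k :: real) < 1"
          using that pi_gt_zero by (auto simp: zero_less_mult_iff simp del: of_int_less_1_iff)
        then show False by simp
      qed
      ultimately show False by blast
    qed
  qed auto
  ultimately have "card {..<N} \<le> card (cusps p)"
    using True by (intro card_inj_on_le) auto
  then show ?thesis using True by (simp add: num_cusps_def)
qed

section \<open>Fourier coefficients\<close>

definition fourier_cos :: "nat \<Rightarrow> (real \<Rightarrow> real) \<Rightarrow> real" where
  "fourier_cos k f = integral {0..2*pi} (\<lambda>x. f x * cos (real k * x))"

definition fourier_sin :: "nat \<Rightarrow> (real \<Rightarrow> real) \<Rightarrow> real" where
  "fourier_sin k f = integral {0..2*pi} (\<lambda>x. f x * sin (real k * x))"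

lemma fourier_sin_0 [simp]: "fourier_sin 0 f = 0"
  by (simp add: fourier_sin_def)

lemma fourier_linear_combination:
  assumes "continuous_on {0..2*pi} f" "continuous_on {0..2*pi} g"
  shows "fourier_cos k (\<lambda>x. a * f x + b * g x) = a * fourier_cos k f + b * fourier_cos k g"
    and "fourier_sin k (\<lambda>x. a * f x + b * g x) = a * fourier_sin k f + b * fourier_sin k g"
proof -
  have "integral {0..2*pi} (\<lambda>x. (a * f x + b * g x) * h x) =
      a * integral {0..2*pi} (\<lambda>x. f x * h x) + b * integral {0..2*pi} (\<lambda>x. g x * h x)"
    if h: "continuous_on {0..2*pi} h" for h :: "real \<Rightarrow> real"
  proof -
    have "integral {0..2*pi} (\<lambda>x. (a * f x + b * g x) * h x) =
      integral {0..2*pi} (\<lambda>x. a * (f x * h x) + b * (g x * h x))"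
      by (simp add: algebra_simps)
    also have "\<dots> = integral {0..2*pi} (\<lambda>x. a * (f x * h x)) + integral {0..2*pi} (\<lambda>x. b * (g x * h x))"
      by (rule integral_add) (auto intro!: integrable_continuous_interval continuous_intros assms h)
    finally show ?thesis by simp
  qed
  from this[of "\<lambda>x. cos (real k * x)"] this[of "\<lambda>x. sin (real k * x)"]
  show "fourier_cos k (\<lambda>x. a * f x + b * g x) = a * fourier_cos k f + b * fourier_cos k g"
    and "fourier_sin k (\<lambda>x. a * f x + b * g x) = a * fourier_sin k f + b * fourier_sin k g"
    unfolding fourier_cos_def fourier_sin_def by (simp_all add: continuous_intros)
qed

lemma integral_deriv_periodic:
  assumes "\<And>x. (F has_real_derivative F' x) (at x)" "F (2 * pi) = F 0"
  shows "integral {0..2*pi} F' = 0"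
proof -
  have "(F' has_integral F (2 * pi) - F 0) {0..2*pi}"
    by (rule fundamental_theorem_of_calculus)
      (auto intro: assms has_field_derivative_at_within
        simp: has_real_derivative_iff_has_vector_derivative[symmetric])
  then show ?thesis using assms(2) by (simp add: integral_unique)
qed

lemma cos_int_2pi: "cos (of_int k * (2 * pi)) = 1" and sin_int_2pi: "sin (of_int k * (2 * pi)) = 0"
  by (simp_all only: mult.commute[of _ "2 * pi"] cos_int_2pin sin_int_2pin)

lemma integral_cos_int:
  "integral {0..2*pi} (\<lambda>x. cos (of_int k * x)) = (if k = 0 then 2 * pi else 0)"
proof (cases "k = 0")
  case False
  have "integral {0..2*pi} (\<lambda>x. cos (of_int k * x)) = 0"
  proof (rule integral_deriv_periodic[where F = "\<lambda>x. sin (of_int k * x) / of_int k"])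
    show "((\<lambda>x. sin (of_int k * x) / of_int k) has_real_derivative cos (of_int k * x)) (at x)" for x
      using False by (auto intro!: derivative_eq_intros)
  qed (simp add: sin_int_2pi)
  then show ?thesis using False by simp
qed simp

lemma integral_sin_int: "integral {0..2*pi} (\<lambda>x. sin (of_int k * x)) = 0"
proof (cases "k = 0")
  case False
  show ?thesis
  proof (rule integral_deriv_periodic[where F = "\<lambda>x. - cos (of_int k * x) / of_int k"])
    show "((\<lambda>x. - cos (of_int k * x) / of_int k) has_real_derivative sin (of_int k * x)) (at x)" for x
      using False by (auto intro!: derivative_eq_intros)
  qed (simp add: cos_int_2pi)
qed simp

lemma fourier_cos_harmonic:
  "fourier_cos l (\<lambda>x. cos (real k * x)) = (if k = l then if k = 0 then 2 * pi else pi else 0)"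
  "fourier_cos l (\<lambda>x. sin (real k * x)) = 0"
  and fourier_sin_harmonic:
  "fourier_sin l (\<lambda>x. cos (real k * x)) = 0"
  "fourier_sin l (\<lambda>x. sin (real k * x)) = (if k = l \<and> k \<noteq> 0 then pi else 0)"
proof -
  let ?p = "int k + int l" and ?m = "int k - int l"
  have add: "integral {0..2*pi} (\<lambda>x. f x / 2 + g x / 2) =
      integral {0..2*pi} f / 2 + integral {0..2*pi} g / 2"
    if "continuous_on {0..2*pi} f" "continuous_on {0..2*pi} g" for f g :: "real \<Rightarrow> real"
    using that by (subst integral_add) (auto intro!: integrable_continuous_interval continuous_intros)
  have diff: "integral {0..2*pi} (\<lambda>x. f x / 2 - g x / 2) =
      integral {0..2*pi} f / 2 - integral {0..2*pi} g / 2"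
    if "continuous_on {0..2*pi} f" "continuous_on {0..2*pi} g" for f g :: "real \<Rightarrow> real"
    using that by (subst integral_diff) (auto intro!: integrable_continuous_interval continuous_intros)
  have "(\<lambda>x. cos (real k * x) * cos (real l * x)) =
      (\<lambda>x. cos (of_int ?m * x) / 2 + cos (of_int ?p * x) / 2)"
    by (simp add: fun_eq_iff cos_times_cos left_diff_distrib distrib_right add_divide_distrib)
  then show "fourier_cos l (\<lambda>x. cos (real k * x)) = (if k = l then if k = 0 then 2 * pi else pi else 0)"
    unfolding fourier_cos_def
    by (simp only:, subst add) (auto intro!: continuous_intros simp: integral_cos_int simp del: of_int_add of_int_diff)
  have "(\<lambda>x. sin (real k * x) * cos (real l * x)) =
      (\<lambda>x. sin (of_int ?m * x) / 2 + sin (of_int ?p * x) / 2)"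
    by (simp add: fun_eq_iff sin_times_cos left_diff_distrib distrib_right add_divide_distrib)
  then show "fourier_cos l (\<lambda>x. sin (real k * x)) = 0"
    unfolding fourier_cos_def
    by (simp only:, subst add) (auto intro!: continuous_intros simp: integral_sin_int simp del: of_int_add of_int_diff)
  have "(\<lambda>x. cos (real k * x) * sin (real l * x)) =
      (\<lambda>x. sin (of_int ?p * x) / 2 - sin (of_int ?m * x) / 2)"
    by (simp add: fun_eq_iff cos_times_sin left_diff_distrib distrib_right diff_divide_distrib)
  then show "fourier_sin l (\<lambda>x. cos (real k * x)) = 0"
    unfolding fourier_sin_def
    by (simp only:, subst diff) (auto intro!: continuous_intros simp: integral_sin_int simp del: of_int_add of_int_diff)
  have "(\<lambda>x. sin (real k * x) * sin (real l * x)) =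
      (\<lambda>x. cos (of_int ?m * x) / 2 - cos (of_int ?p * x) / 2)"
    by (simp add: fun_eq_iff sin_times_sin left_diff_distrib distrib_right diff_divide_distrib)
  then show "fourier_sin l (\<lambda>x. sin (real k * x)) = (if k = l \<and> k \<noteq> 0 then pi else 0)"
    unfolding fourier_sin_def
    by (simp only:, subst diff) (auto intro!: continuous_intros simp: integral_cos_int simp del: of_int_add of_int_diff)
qed

lemma fourier_deriv:
  assumes "hedgehog f"
  shows "fourier_cos k (deriv f) = real k * fourier_sin k f"
    and "fourier_sin k (deriv f) = - real k * fourier_cos k f"
proof -
  note c = hedgehog_continuous[OF assms] hedgehog_continuous[OF hedgehog_deriv[OF assms]]
  have per: "f (2 * pi) = f 0" using hedgehog_periodic[OF assms, of 0] by simp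
  have k: "cos (real k * (2 * pi)) = 1" "sin (real k * (2 * pi)) = 0"
    using cos_int_2pi[of "int k"] sin_int_2pi[of "int k"] by auto
  have "integral {0..2*pi} (\<lambda>x. deriv f x * cos (real k * x) - real k * (f x * sin (real k * x))) = 0"
    by (rule integral_deriv_periodic[where F = "\<lambda>x. f x * cos (real k * x)"])
      ((rule derivative_eq_intros hedgehog_DERIV assms refl | simp)+, simp add: per k)
  moreover have "integral {0..2*pi} (\<lambda>x. deriv f x * cos (real k * x) - real k * (f x * sin (real k * x)))
      = fourier_cos k (deriv f) - integral {0..2*pi} (\<lambda>x. real k * (f x * sin (real k * x)))"
    unfolding fourier_cos_def
    by (rule integral_diff) (auto intro!: integrable_continuous_interval continuous_intros c)
  ultimately show "fourier_cos k (deriv f) = real k * fourier_sin k f"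
    by (simp add: fourier_sin_def)
  have "integral {0..2*pi} (\<lambda>x. deriv f x * sin (real k * x) + real k * (f x * cos (real k * x))) = 0"
    by (rule integral_deriv_periodic[where F = "\<lambda>x. f x * sin (real k * x)"])
      ((rule derivative_eq_intros hedgehog_DERIV assms refl | simp)+, simp add: per k)
  moreover have "integral {0..2*pi} (\<lambda>x. deriv f x * sin (real k * x) + real k * (f x * cos (real k * x)))
      = fourier_sin k (deriv f) + integral {0..2*pi} (\<lambda>x. real k * (f x * cos (real k * x)))"
    unfolding fourier_sin_def
    by (rule integral_add) (auto intro!: integrable_continuous_interval continuous_intros c)
  ultimately show "fourier_sin k (deriv f) = - real k * fourier_cos k f"
    by (simp add: fourier_cos_def)
qed

section \<open>Uniqueness of Fourier coefficients\<close>

definition modeless :: "(real \<Rightarrow> real) \<Rightarrow> bool" where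
  "modeless f \<longleftrightarrow> continuous_on UNIV f \<and> (\<forall>k. fourier_cos k f = 0 \<and> fourier_sin k f = 0)"

lemma modeless_linear_combination:
  "modeless f \<Longrightarrow> modeless g \<Longrightarrow> modeless (\<lambda>x. a * f x + b * g x)"
  unfolding modeless_def
  by (auto intro!: continuous_intros simp: fourier_linear_combination continuous_on_subset[of UNIV])

text \<open>Multiplying by \<open>cos x\<close> or \<open>sin x\<close> only mixes the coefficients of index \<open>k - 1\<close> and \<open>k + 1\<close>. Therefore the
  functions with vanishing coefficients form a module over the polynomials in \<open>cos x\<close> and \<open>sin x\<close>.\<close>

lemma modeless_times_cos_sin:
  assumes "modeless f"
  shows "modeless (\<lambda>x. f x * cos x)" "modeless (\<lambda>x. f x * sin x)"
proof -
  have cont: "continuous_on A f" for A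
    using assms continuous_on_subset unfolding modeless_def by blast
  have z: "integral {0..2*pi} (\<lambda>x. f x * cos (real k * x)) = 0"
       "integral {0..2*pi} (\<lambda>x. f x * sin (real k * x)) = 0" for k
    using assms by (auto simp: modeless_def fourier_cos_def fourier_sin_def)
  have zi: "integral {0..2*pi} (\<lambda>x. f x * cos (of_int k * x)) = 0"
       "integral {0..2*pi} (\<lambda>x. f x * sin (of_int k * x)) = 0" for k
  proof -
    \<comment> \<open>Up to sign, a negative index gives the coefficient of its absolute value.\<close>
    obtain n where "k = int n \<or> k = - int n" by (metis int_cases2)
    then show "integral {0..2*pi} (\<lambda>x. f x * cos (of_int k * x)) = 0"
       "integral {0..2*pi} (\<lambda>x. f x * sin (of_int k * x)) = 0"
      using z[of n] by auto
  qed
  have comb: "integral {0..2*pi} (\<lambda>x. s * (f x * u x) + t * (f x * v x)) = 0"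
    if "integral {0..2*pi} (\<lambda>x. f x * u x) = 0" "integral {0..2*pi} (\<lambda>x. f x * v x) = 0"
      "continuous_on {0..2*pi} u" "continuous_on {0..2*pi} v" for u v :: "real \<Rightarrow> real" and s t
    using that by (subst integral_add) (auto intro!: integrable_continuous_interval continuous_intros cont)
  have "fourier_cos k (\<lambda>x. f x * cos x) = 0" for k
  proof -
    have "(\<lambda>x. f x * cos x * cos (real k * x)) =
      (\<lambda>x. (1/2) * (f x * cos (of_int (int k + 1) * x)) + (1/2) * (f x * cos (of_int (int k - 1) * x)))"
      by (simp add: fun_eq_iff cos_add cos_diff algebra_simps)
    then show ?thesis unfolding fourier_cos_def
      by (simp only:, intro comb) (auto intro!: continuous_intros simp: zi simp del: of_int_add of_int_diff)
  qed
  moreover have "fourier_sin k (\<lambda>x. f x * cos x) = 0" for k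
  proof -
    have "(\<lambda>x. f x * cos x * sin (real k * x)) =
      (\<lambda>x. (1/2) * (f x * sin (of_int (int k + 1) * x)) + (1/2) * (f x * sin (of_int (int k - 1) * x)))"
      by (simp add: fun_eq_iff sin_add sin_diff algebra_simps)
    then show ?thesis unfolding fourier_sin_def
      by (simp only:, intro comb) (auto intro!: continuous_intros simp: zi simp del: of_int_add of_int_diff)
  qed
  moreover have "fourier_cos k (\<lambda>x. f x * sin x) = 0" for k
  proof -
    have "(\<lambda>x. f x * sin x * cos (real k * x)) =
      (\<lambda>x. (1/2) * (f x * sin (of_int (int k + 1) * x)) + (-1/2) * (f x * sin (of_int (int k - 1) * x)))"
      by (simp add: fun_eq_iff sin_add sin_diff algebra_simps)
    then show ?thesis unfolding fourier_cos_def
      by (simp only:, intro comb) (auto intro!: continuous_intros simp: zi simp del: of_int_add of_int_diff)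
  qed
  moreover have "fourier_sin k (\<lambda>x. f x * sin x) = 0" for k
  proof -
    have "(\<lambda>x. f x * sin x * sin (real k * x)) =
      (\<lambda>x. (1/2) * (f x * cos (of_int (int k - 1) * x)) + (-1/2) * (f x * cos (of_int (int k + 1) * x)))"
      by (simp add: fun_eq_iff cos_add cos_diff algebra_simps)
    then show ?thesis unfolding fourier_sin_def
      by (simp only:, intro comb) (auto intro!: continuous_intros simp: zi simp del: of_int_add of_int_diff)
  qed
  ultimately show "modeless (\<lambda>x. f x * cos x)" "modeless (\<lambda>x. f x * sin x)"
    by (auto simp: modeless_def intro!: continuous_intros cont)
qed

lemma modeless_times_polynomial:
  fixes q :: "complex \<Rightarrow> real"
  assumes "real_polynomial_function q"
  shows "modeless f \<Longrightarrow> modeless (\<lambda>x. f x * q (cis x))"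
  using assms
proof (induction q arbitrary: f rule: real_polynomial_function.induct)
  case (linear q)
  interpret q: bounded_linear q by (rule linear)
  have "q (cis x) = cos x * q 1 + sin x * q \<i>" for x
  proof -
    have "cis x = cos x *\<^sub>R 1 + sin x *\<^sub>R \<i>" by (simp add: complex_eq_iff)
    then show ?thesis by (simp only: q.add q.scaleR real_scaleR_def)
  qed
  then have "(\<lambda>x. f x * q (cis x)) = (\<lambda>x. q 1 * (f x * cos x) + q \<i> * (f x * sin x))"
    by (simp add: algebra_simps)
  then show ?case
    using modeless_linear_combination modeless_times_cos_sin[OF linear(2)] by simp
next
  case (const c)
  then show ?case using modeless_linear_combination[of f f c 0] by (simp add: mult.commute)
next
  case (add q1 q2)
  then show ?case
    using modeless_linear_combination[of "\<lambda>x. f x * q1 (cis x)" "\<lambda>x. f x * q2 (cis x)" 1 1]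
    by (simp add: algebra_simps)
next
  case (mult q1 q2)
  then show ?case by (simp add: mult.assoc[symmetric])
qed

text \<open>The function \<open>f \<circ> Arg\<close> is continuous off the nonpositive real axis. Near that axis, periodicity allows
  replacing \<open>Arg z\<close> by the other branch \<open>Arg (- z) + \<pi>\<close>, which is continuous there.\<close>

lemma periodic_on_circle:
  fixes f :: "real \<Rightarrow> real"
  assumes cont: "continuous_on UNIV f" and per: "\<And>x. f (x + 2 * pi) = f x"
  obtains F where "continuous_on (sphere 0 1) F" "\<And>x. F (cis x) = f x"
proof -
  have eq: "f x = f y" if "cis x = cis y" for x y
  proof -
    have "sin x = sin y \<and> cos x = cos y" using that by (simp add: complex_eq_iff)
    then obtain n where "x = y + 2 * pi * of_int n" using sin_cos_eq_iff by (metis mult.commute)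
    then show ?thesis using periodic_shift_int[of f, OF per] by simp
  qed
  define F where "F z = f (Arg z)" for z
  have fc: "isCont f x" for x using cont by (simp add: continuous_on_eq_continuous_at)
  have F2: "F z = f (Arg (- z) + pi)" if "z \<noteq> 0" for z
    unfolding F_def
  proof (rule eq)
    have "cis (Arg (- z) + pi) = sgn z"
      using that cis_Arg[of "- z"] by (simp add: cis_mult[symmetric] sgn_minus)
    then show "cis (Arg z) = cis (Arg (- z) + pi)" using that cis_Arg by simp
  qed
  have "isCont F z" if z: "z \<noteq> 0" for z
  proof (cases "z \<in> \<real>\<^sub>\<le>\<^sub>0")
    case False
    then show ?thesis unfolding F_def
      by (intro isCont_o2[OF continuous_at_Arg] fc)
  next
    case True
    then have "- z \<notin> \<real>\<^sub>\<le>\<^sub>0" using z by (auto simp: complex_nonpos_Reals_iff complex_eq_iff)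
    then have "isCont (\<lambda>z. Arg (- z)) z"
      by (intro isCont_o2[OF _ continuous_at_Arg]) auto
    then have "isCont (\<lambda>z. f (Arg (- z) + pi)) z"
      by (intro isCont_o2[OF _ fc]) auto
    moreover have ev: "\<forall>\<^sub>F w in nhds z. F w = f (Arg (- w) + pi)"
      using t1_space_nhds[OF z] F2 by (auto elim: eventually_mono)
    ultimately show ?thesis by (simp add: isCont_cong[OF ev])
  qed
  moreover have "z \<noteq> 0" if "z \<in> sphere 0 1" for z :: complex using that by auto
  ultimately have "continuous_on (sphere 0 1) F"
    by (intro continuous_at_imp_continuous_on ballI) blast
  moreover have "F (cis x) = f x" for x
    unfolding F_def by (rule eq) (simp add: cis_Arg)
  ultimately show ?thesis by (rule that)
qed

text \<open>Such an \<open>f\<close> is orthogonal to every polynomial in \<open>cos x\<close> and \<open>sin x\<close>, while by Stone-Weierstrass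
  on the unit circle these polynomials approximate \<open>f\<close> itself uniformly. So \<open>f\<close> is orthogonal to
  itself.\<close>

lemma modeless_periodic_eq_0:
  assumes f: "modeless f" and per: "\<And>x. f (x + 2 * pi) = f x"
  shows "f x = 0"
proof -
  have cont: "continuous_on A f" for A
    using f continuous_on_subset unfolding modeless_def by blast
  obtain F where F: "continuous_on (sphere 0 1) F" "\<And>x. F (cis x) = f x"
    using periodic_on_circle[OF cont per] by blast
  let ?I = "integral {0..2*pi}"
  have "?I (\<lambda>x. f x * f x) \<le> 0 + e" if "e > 0" for e
  proof -
    define d where "d = e / (?I (\<lambda>x. \<bar>f x\<bar>) + 1)"
    have I0: "0 \<le> ?I (\<lambda>x. \<bar>f x\<bar>)"
      by (intro integral_nonneg integrable_continuous_interval continuous_intros cont) auto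
    then have d: "0 < d" "d * ?I (\<lambda>x. \<bar>f x\<bar>) \<le> e"
      using \<open>e > 0\<close> by (auto simp: d_def field_simps)
    obtain q where q: "real_polynomial_function q" "\<And>z. z \<in> sphere 0 1 \<Longrightarrow> \<bar>F z - q z\<bar> < d"
      using Stone_Weierstrass_real_polynomial_function[OF compact_sphere F(1) d(1)] by blast
    have "continuous_on UNIV q"
      using q(1) by (simp add: real_polynomial_function_eq continuous_on_polymonial_function)
    then have qc: "continuous_on A (\<lambda>x. q (cis x))" for A
      by (rule continuous_on_compose2) (auto intro!: continuous_intros)
    have "fourier_cos 0 (\<lambda>x. f x * q (cis x)) = 0"
      using modeless_times_polynomial[OF q(1) f] by (simp add: modeless_def)
    then have "?I (\<lambda>x. f x * q (cis x)) = 0" by (simp add: fourier_cos_def)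
    then have "?I (\<lambda>x. f x * f x) = ?I (\<lambda>x. f x * f x - f x * q (cis x))"
      by (subst integral_diff)
        (auto intro!: integrable_continuous_interval continuous_intros cont qc)
    also have "\<dots> \<le> ?I (\<lambda>x. d * \<bar>f x\<bar>)"
    proof (rule integral_le)
      fix x
      have "\<bar>f x - q (cis x)\<bar> \<le> d" using q(2)[of "cis x"] F(2) by auto
      then have "\<bar>f x\<bar> * \<bar>f x - q (cis x)\<bar> \<le> \<bar>f x\<bar> * d" by (intro mult_left_mono) auto
      then have "\<bar>f x * (f x - q (cis x))\<bar> \<le> d * \<bar>f x\<bar>" by (simp add: abs_mult mult.commute)
      then show "f x * f x - f x * q (cis x) \<le> d * \<bar>f x\<bar>" by (simp add: algebra_simps)
    qed (auto intro!: integrable_continuous_interval continuous_intros cont qc)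
    also have "\<dots> \<le> e" using d by simp
    finally show ?thesis by simp
  qed
  then have "?I (\<lambda>x. f x * f x) \<le> 0" by (rule field_le_epsilon)
  moreover have "0 \<le> ?I (\<lambda>x. f x * f x)"
    by (intro integral_nonneg integrable_continuous_interval continuous_intros cont) auto
  ultimately have "?I (\<lambda>x. f x * f x) = 0" by simp
  then have "\<forall>x\<in>{0..2*pi}. f x * f x = 0"
    by (subst integral_eq_0_iff[symmetric]) (auto intro!: continuous_intros cont)
  then have z: "f x = 0" if "x \<in> {0..2*pi}" for x using that by auto
  show ?thesis using periodic_all[of f "\<lambda>y. y = 0", OF per z] .
qed

text \<open>Subtracting the Fourier polynomial \<open>t\<close> of degree \<open>M\<close> leaves a function without any harmonics.\<close>

lemma trig_polynomial_if_high_coeffs_0: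
  assumes p: "hedgehog p"
    and high: "\<And>k. k > M \<Longrightarrow> fourier_cos k p = 0 \<and> fourier_sin k p = 0"
  shows "trig_polynomial p"
proof -
  define a where "a k = fourier_cos k p / (if k = 0 then 2 * pi else pi)" for k
  define b where "b k = fourier_sin k p / pi" for k
  define t where "t x = (\<Sum>k\<le>M. a k * cos (real k * x) + b k * sin (real k * x))" for x
  have tc: "continuous_on A t" for A unfolding t_def by (intro continuous_intros)
  note pc = hedgehog_continuous[OF p]
  let ?f = "\<lambda>x. 1 * p x + (-1) * t x"
  have t: "fourier_cos l t = (if l \<le> M then fourier_cos l p else 0)"
      "fourier_sin l t = (if l \<le> M then fourier_sin l p else 0)" for l
  proof -
    have ex: "integral {0..2*pi} (\<lambda>x. t x * h x) = (\<Sum>k\<le>M. integral {0..2*pi}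
        (\<lambda>x. (a k * cos (real k * x) + b k * sin (real k * x)) * h x))"
      if "continuous_on {0..2*pi} h" for h
      unfolding t_def sum_distrib_right using that
      by (intro integral_sum) (auto intro!: integrable_continuous_interval continuous_intros)
    have h: "continuous_on {0..2*pi} (\<lambda>x. cos (real k * x))"
      "continuous_on {0..2*pi} (\<lambda>x. sin (real k * x))" for k by (intro continuous_intros)+
    note lin = fourier_linear_combination[OF h(1) h(2)]
    have "fourier_cos l t = (\<Sum>k\<le>M. fourier_cos l (\<lambda>x. a k * cos (real k * x) + b k * sin (real k * x)))"
      unfolding fourier_cos_def by (rule ex) (intro continuous_intros)
    also have "\<dots> = (\<Sum>k\<le>M. if l = k then fourier_cos l p else 0)"
      unfolding lin fourier_cos_harmonic by (intro sum.cong) (auto simp: a_def)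
    finally show "fourier_cos l t = (if l \<le> M then fourier_cos l p else 0)" by simp
    have "fourier_sin l t = (\<Sum>k\<le>M. fourier_sin l (\<lambda>x. a k * cos (real k * x) + b k * sin (real k * x)))"
      unfolding fourier_sin_def by (rule ex) (intro continuous_intros)
    also have "\<dots> = (\<Sum>k\<le>M. if l = k then fourier_sin l p else 0)"
      unfolding lin fourier_sin_harmonic by (intro sum.cong) (auto simp: b_def)
    finally show "fourier_sin l t = (if l \<le> M then fourier_sin l p else 0)" by simp
  qed
  have "modeless ?f"
    unfolding modeless_def fourier_linear_combination[OF pc tc]
    by (auto simp: t high intro!: continuous_intros pc tc)
  moreover have "t (x + 2 * pi) = t x" for x
  proof -
    have "cos (real k * (x + 2 * pi)) = cos (real k * x)"
      "sin (real k * (x + 2 * pi)) = sin (real k * x)" for k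
      using cos_int_2pi[of "int k"] sin_int_2pi[of "int k"]
      by (auto simp: distrib_left cos_add sin_add)
    then show ?thesis by (simp add: t_def)
  qed
  ultimately have "?f x = 0" for x
    using hedgehog_periodic[OF p] by (intro modeless_periodic_eq_0) auto
  then have "p x = t x" for x by simp
  then show ?thesis unfolding trig_polynomial_def t_def by blast
qed

section \<open>The smoothing operator\<close>

text \<open>The operator \<open>k\<^sup>2 - D\<^sup>2\<close>, of modified Helmholtz (screened Poisson) type. Its periodic inverse is the
  smoothing that damps high frequencies without creating sign changes.\<close>

definition helmholtz :: "real \<Rightarrow> (real \<Rightarrow> real) \<Rightarrow> real \<Rightarrow> real" where
  "helmholtz k u = (\<lambda>x. k\<^sup>2 * u x - deriv (deriv u) x)"

lemma helmholtz_eq_linear_combination: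
  "helmholtz k u = (\<lambda>x. k\<^sup>2 * u x + (-1) * deriv (deriv u) x)"
  by (simp add: helmholtz_def)

lemma helmholtz_factor:
  assumes "hedgehog u"
  shows "helmholtz k u = (\<lambda>x. (-1) * damped_deriv (- k) (damped_deriv k u) x)"
  using deriv_damped_deriv[OF assms, of k]
  by (simp add: fun_eq_iff helmholtz_def damped_deriv_def[of "- k"] damped_deriv_def[of k]
    power2_eq_square algebra_simps)

lemma alternates_helmholtz:
  assumes "hedgehog u" "alternates N u"
  shows "alternates N (helmholtz k u)"
proof -
  have "alternates N (damped_deriv (- k) (damped_deriv k u))"
    using assms by (intro alternates_damped_deriv hedgehog_damped_deriv)
  from alternates_scaled_shift[OF this, of "-1" 0] show ?thesis
    by (simp add: helmholtz_factor[OF assms(1)])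
qed

lemma helmholtz_surj:
  assumes f: "hedgehog f" and k: "k \<noteq> 0"
  obtains u where "hedgehog u" "helmholtz k u = f"
proof -
  have "hedgehog (\<lambda>x. (-1) * f x + 0 * f x)"
    using f by (intro hedgehog_linear_combination)
  then obtain h where h: "hedgehog h" "damped_deriv (- k) h = (\<lambda>x. (-1) * f x + 0 * f x)"
    using k damped_deriv_surj[of _ "- k"] by (metis neg_equal_0_iff_equal)
  obtain u where u: "hedgehog u" "damped_deriv k u = h"
    using damped_deriv_surj[OF h(1) k] by blast
  have "helmholtz k u = f"
    using h u by (simp add: helmholtz_factor)
  with u(1) show ?thesis by (rule that)
qed

lemma helmholtz_damped_deriv_commute:
  assumes "hedgehog u"
  shows "damped_deriv c (helmholtz k u) = helmholtz k (damped_deriv c u)"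
  unfolding helmholtz_eq_linear_combination
  by (simp only: damped_deriv_linear_combination deriv_damped_deriv hedgehog_deriv assms)

lemma helmholtz_damped_deriv_funpow_commute:
  assumes "hedgehog u"
  shows "(damped_deriv c ^^ n) (helmholtz k u) = helmholtz k ((damped_deriv c ^^ n) u)"
  by (induction n)
    (simp_all add: helmholtz_damped_deriv_commute hedgehog_damped_deriv_funpow assms)

section \<open>Energy and the selection of a harmonic\<close>

definition energy :: "(real \<Rightarrow> real) \<Rightarrow> real" where
  "energy f = integral {0..2*pi} (\<lambda>x. (f x)\<^sup>2)"

lemma energy_nonneg: "0 \<le> energy f"
  unfolding energy_def
  by (cases "(\<lambda>x. (f x)\<^sup>2) integrable_on {0..2*pi}")
    (auto intro: integral_nonneg simp: not_integrable_integral)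

definition mode_power :: "nat \<Rightarrow> (real \<Rightarrow> real) \<Rightarrow> real" where
  "mode_power m f = (fourier_cos m f)\<^sup>2 + (fourier_sin m f)\<^sup>2"

text \<open>Harmonics of frequency \<open>m\<close> diagonalise constant-coefficient operators: the multiplier \<open>c + i m\<close> of
  \<open>D + c\<close> has squared modulus \<open>c\<^sup>2 + m\<^sup>2\<close>.\<close>

lemma mode_power_damped_deriv:
  assumes "hedgehog u"
  shows "mode_power m (damped_deriv c u) = (c\<^sup>2 + (real m)\<^sup>2) * mode_power m u"
proof -
  have e: "damped_deriv c u = (\<lambda>x. c * u x + 1 * deriv u x)" by (simp add: damped_deriv_def)
  note co = hedgehog_continuous[OF assms] hedgehog_continuous[OF hedgehog_deriv[OF assms]]
  show ?thesis
    unfolding mode_power_def e fourier_linear_combination[OF co] fourier_deriv[OF assms]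
    by (simp add: power2_eq_square algebra_simps)
qed

lemma mode_power_second_order:
  assumes "hedgehog u"
  shows "mode_power m (\<lambda>x. a * u x + b * deriv (deriv u) x) =
    (a - b * (real m)\<^sup>2)\<^sup>2 * mode_power m u"
proof -
  note co = hedgehog_continuous[OF assms] hedgehog_continuous[OF hedgehog_deriv[OF hedgehog_deriv[OF assms]]]
  show ?thesis
    unfolding mode_power_def fourier_linear_combination[OF co] fourier_deriv[OF hedgehog_deriv[OF assms]]
      fourier_deriv[OF assms]
    by (simp add: power2_eq_square algebra_simps)
qed

lemma mode_power_helmholtz:
  assumes "hedgehog u"
  shows "mode_power m (helmholtz k u) = (k\<^sup>2 + (real m)\<^sup>2)\<^sup>2 * mode_power m u"
  unfolding helmholtz_eq_linear_combination mode_power_second_order[OF assms] by simp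

text \<open>This is \<open>(w + t)\<^sup>2 = 4 w t + (w - t)\<^sup>2\<close> for the operator \<open>t = c\<^sup>2 - D\<^sup>2\<close>, whose quadratic form is the
  energy of \<open>(D + c) u\<close>. Pointwise, the two sides differ by a multiple of the derivative of the
  periodic function \<open>u u' + c u\<^sup>2\<close>.\<close>

lemma energy_identity:
  fixes c \<omega> :: real
  assumes u: "hedgehog u" and w: "w = c\<^sup>2 + \<omega>\<^sup>2" and k: "k\<^sup>2 = w + c\<^sup>2"
  shows "energy (helmholtz k u) =
    4 * w * energy (damped_deriv c u) + energy (\<lambda>x. \<omega>\<^sup>2 * u x + deriv (deriv u) x)"
proof -
  note h = u hedgehog_deriv[OF u] hedgehog_deriv[OF hedgehog_deriv[OF u]]
  note co = h[THEN hedgehog_continuous]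
  let ?D = "\<lambda>x. deriv u x * deriv u x + u x * deriv (deriv u) x + 2 * c * (u x * deriv u x)"
  have per: "u (2 * pi) = u 0" "deriv u (2 * pi) = deriv u 0"
    using hedgehog_periodic[of _ 0] h by auto
  have "integral {0..2*pi} ?D = 0"
    by (rule integral_deriv_periodic[where F = "\<lambda>x. u x * deriv u x + c * (u x * u x)"])
      ((rule derivative_eq_intros hedgehog_DERIV h refl | simp)+, simp add: per)
  moreover have "(helmholtz k u x)\<^sup>2 = 4 * w * (damped_deriv c u x)\<^sup>2 +
      (\<omega>\<^sup>2 * u x + deriv (deriv u) x)\<^sup>2 - 4 * w * ?D x" for x
    unfolding helmholtz_def damped_deriv_def k w by algebra
  then have "energy (helmholtz k u) = integral {0..2*pi} (\<lambda>x. 4 * w * (damped_deriv c u x)\<^sup>2 +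
      (\<omega>\<^sup>2 * u x + deriv (deriv u) x)\<^sup>2 - 4 * w * ?D x)"
    by (simp add: energy_def)
  moreover have "\<dots> = integral {0..2*pi} (\<lambda>x. 4 * w * (damped_deriv c u x)\<^sup>2) +
      integral {0..2*pi} (\<lambda>x. (\<omega>\<^sup>2 * u x + deriv (deriv u) x)\<^sup>2) - integral {0..2*pi} (\<lambda>x. 4 * w * ?D x)"
    unfolding damped_deriv_def
    by (subst integral_diff, (intro integrable_continuous_interval continuous_intros co)+,
        subst integral_add, (intro integrable_continuous_interval continuous_intros co)+, rule refl)
  moreover have "integral {0..2*pi} (\<lambda>x. 4 * w * ?D x) = 4 * w * integral {0..2*pi} ?D"
    by (rule integral_mult_right)
  ultimately show ?thesis by (simp add: energy_def)
qed

text \<open>The variation of \<open>F\<close> is at most the integral of \<open>\<bar>e\<bar>\<close>, and \<open>\<bar>e\<bar> \<le> (s + e\<^sup>2 / s) / 2\<close> bounds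
  that integral by \<open>(\<pi> + 1/2) s\<close>.\<close>

lemma oscillation_le_energy:
  assumes F: "\<And>t. (F has_real_derivative F' t) (at t)" "\<And>t. \<bar>F' t\<bar> \<le> \<bar>e t\<bar>"
    and e: "continuous_on UNIV e" "energy e \<le> s\<^sup>2" and s: "s > 0" and x: "x \<in> {0..2*pi}"
  shows "\<bar>F x - F 0\<bar> \<le> 4 * s"
proof -
  have co: "continuous_on A e" for A using e(1) continuous_on_subset by blast
  let ?b = "\<lambda>t. s / 2 + (e t)\<^sup>2 / (2 * s)"
  have "\<bar>F' t\<bar> \<le> ?b t" for t
  proof -
    have "0 \<le> (\<bar>e t\<bar> - s)\<^sup>2" by simp
    then have "2 * s * \<bar>e t\<bar> \<le> s\<^sup>2 + (e t)\<^sup>2" by (simp add: power2_diff mult_ac)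
    then have "\<bar>e t\<bar> \<le> ?b t" using s by (simp add: field_simps power2_eq_square)
    then show ?thesis using F(2)[of t] by linarith
  qed
  moreover have I: "(F' has_integral F x - F 0) {0..x}"
    using x by (intro fundamental_theorem_of_calculus)
      (auto intro: F has_field_derivative_at_within
          simp: has_real_derivative_iff_has_vector_derivative[symmetric])
  moreover have b: "?b integrable_on {0..y}" for y
    using s by (intro integrable_continuous_interval continuous_intros co) auto
  ultimately have "norm (integral {0..x} F') \<le> integral {0..x} ?b"
    by (intro integral_norm_bound_integral) (auto simp: has_integral_integrable)
  also have "\<dots> \<le> integral {0..2*pi} ?b"
    using x s b by (intro integral_subset_le) auto
  also have "\<dots> = pi * s + energy e / (2 * s)"
    using s unfolding energy_def
    by (subst integral_add) (auto intro!: integrable_continuous_interval continuous_intros co)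
  also have "\<dots> \<le> pi * s + s / 2"
    using e(2) s by (auto simp: field_simps power2_eq_square)
  also have "\<dots> \<le> 4 * s"
  proof -
    have "pi * s \<le> 3.5 * s" using s pi_approx by (intro mult_right_mono) auto
    then show ?thesis by simp
  qed
  finally show ?thesis using I by (simp add: integral_unique)
qed

text \<open>Variation of constants: writing \<open>u = A cos (m x) + B sin (m x)\<close> and \<open>u' / m = - A sin (m x) + B cos (m x)\<close>,
  the amplitudes \<open>A\<close> and \<open>B\<close> have derivatives bounded by the defect \<open>u'' + m\<^sup>2 u\<close>, so they are almost
  constant.\<close>

lemma near_harmonic:
  assumes u: "hedgehog u" and m: "m > 0" and s: "s > 0"
    and e: "energy (\<lambda>x. (real m)\<^sup>2 * u x + deriv (deriv u) x) \<le> s\<^sup>2"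
  obtains R \<theta> where "\<And>x. \<bar>u x - R * cos (real m * x - \<theta>)\<bar> \<le> 8 * s"
proof -
  note h = u hedgehog_deriv[OF u] hedgehog_deriv[OF hedgehog_deriv[OF u]]
  let ?e = "\<lambda>x. (real m)\<^sup>2 * u x + deriv (deriv u) x"
  define A where "A x = u x * cos (real m * x) - (1 / real m) * (deriv u x * sin (real m * x))" for x
  define B where "B x = u x * sin (real m * x) + (1 / real m) * (deriv u x * cos (real m * x))" for x
  have trig: "cos (real m * (x + 2 * pi)) = cos (real m * x)"
      "sin (real m * (x + 2 * pi)) = sin (real m * x)" for x
    using cos_int_2pi[of "int m"] sin_int_2pi[of "int m"]
    by (auto simp: distrib_left cos_add sin_add)
  have per: "A (x + 2 * pi) = A x" "B (x + 2 * pi) = B x" for x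
    by (simp_all only: A_def B_def trig hedgehog_periodic[OF h(1)] hedgehog_periodic[OF h(2)])
  have t: "((\<lambda>x. cos (real m * x)) has_real_derivative - real m * sin (real m * x)) (at x)"
      "((\<lambda>x. sin (real m * x)) has_real_derivative real m * cos (real m * x)) (at x)" for x
    by (auto intro!: derivative_eq_intros)
  note d = hedgehog_DERIV[OF h(1)] hedgehog_DERIV[OF h(2)]
  have D: "(A has_real_derivative ?e x * (- sin (real m * x)) / real m) (at x)" for x
    using DERIV_diff[OF DERIV_mult[OF d(1) t(1)] DERIV_cmult[OF DERIV_mult[OF d(2) t(2)], of "1 / real m"], of x] m
    unfolding A_def[abs_def] by (rule_tac DERIV_cong) (auto simp: field_simps power2_eq_square)
  have D': "(B has_real_derivative ?e x * cos (real m * x) / real m) (at x)" for x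
    using DERIV_add[OF DERIV_mult[OF d(1) t(2)] DERIV_cmult[OF DERIV_mult[OF d(2) t(1)], of "1 / real m"], of x] m
    unfolding B_def[abs_def] by (rule_tac DERIV_cong) (auto simp: field_simps power2_eq_square)
  have le: "\<bar>?e x * (- sin (real m * x)) / real m\<bar> \<le> \<bar>?e x\<bar>"
      "\<bar>?e x * cos (real m * x) / real m\<bar> \<le> \<bar>?e x\<bar>" for x
  proof -
    have "\<bar>y * t / real m\<bar> \<le> \<bar>y\<bar>" if "\<bar>t\<bar> \<le> 1" for y t :: real
    proof -
      have "\<bar>y\<bar> * \<bar>t\<bar> \<le> \<bar>y\<bar> * real m" using that m by (intro mult_left_mono) auto
      then show ?thesis using m by (simp add: abs_mult field_simps)
    qed
    then show "\<bar>?e x * (- sin (real m * x)) / real m\<bar> \<le> \<bar>?e x\<bar>"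
      "\<bar>?e x * cos (real m * x) / real m\<bar> \<le> \<bar>?e x\<bar>"
      by (simp_all only: abs_minus_cancel abs_sin_le_one abs_cos_le_one)
  qed
  have ec: "continuous_on UNIV ?e" by (intro continuous_intros hedgehog_continuous h)
  have "\<bar>A x - A 0\<bar> \<le> 4 * s" for x
    by (rule periodic_all[of A "\<lambda>y. \<bar>y - A 0\<bar> \<le> 4 * s", OF per(1)])
      (rule oscillation_le_energy[OF D le(1) ec e s])
  moreover have "\<bar>B x - B 0\<bar> \<le> 4 * s" for x
    by (rule periodic_all[of B "\<lambda>y. \<bar>y - B 0\<bar> \<le> 4 * s", OF per(2)])
      (rule oscillation_le_energy[OF D' le(2) ec e s])
  moreover obtain R \<theta> where R: "A 0 = R * cos \<theta>" "B 0 = R * sin \<theta>"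
    using polar_Ex by blast
  have "u x - R * cos (real m * x - \<theta>) =
      (A x - A 0) * cos (real m * x) + (B x - B 0) * sin (real m * x)" for x
  proof -
    have "u x = A x * cos (real m * x) + B x * sin (real m * x)"
      unfolding A_def B_def using sin_cos_squared_add[of "real m * x"] by algebra
    then show ?thesis using R by (simp add: cos_diff algebra_simps)
  qed
  moreover have "\<bar>a * cos y + b * sin y\<bar> \<le> 8 * s" if "\<bar>a\<bar> \<le> 4 * s" "\<bar>b\<bar> \<le> 4 * s" for a b y
  proof -
    have "\<bar>a\<bar> * \<bar>cos y\<bar> \<le> 4 * s * 1" "\<bar>b\<bar> * \<bar>sin y\<bar> \<le> 4 * s * 1"
      using that s by (intro mult_mono; simp)+
    then show ?thesis using abs_triangle_ineq[of "a * cos y" "b * sin y"] by (simp add: abs_mult)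
  qed
  ultimately have "\<bar>u x - R * cos (real m * x - \<theta>)\<bar> \<le> 8 * s" for x by simp
  then show ?thesis by (rule that)
qed

text \<open>The sign changes are seen at the extrema of the cosine.\<close>

lemma near_harmonic_alternates:
  assumes m: "m > 0" and R: "\<bar>R\<bar> > d" and near: "\<And>x. \<bar>u x - R * cos (real m * x - \<theta>)\<bar> \<le> d"
  shows "alternates (2 * m) u"
proof -
  define x where "x j = (\<theta> + real j * pi) / real m" for j
  have x: "\<bar>u (x j) - R * (-1) ^ j\<bar> \<le> d" for j
  proof -
    have "real m * x j - \<theta> = real j * pi" using m by (simp add: x_def)
    then show ?thesis using near[of "x j"] by (simp add: cos_npi)
  qed
  have "u (x j) * u (x (Suc j)) < 0" for j
    using x[of j] x[of "Suc j"] R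
    by (cases "even j"; cases "R > 0") (auto simp: mult_less_0_iff)
  moreover have "x j < x (Suc j)" for j
    using m by (simp add: x_def field_simps)
  moreover have "x (2 * m) = x 0 + 2 * pi"
    using m by (simp add: x_def field_simps)
  ultimately show ?thesis unfolding alternates_def by blast
qed

lemma mode_power_le:
  assumes co: "continuous_on {0..2*pi} u" and b: "\<And>x. \<bar>u x\<bar> \<le> b"
  shows "mode_power m u \<le> 2 * (7 * b)\<^sup>2"
proof -
  have b0: "0 \<le> b" using b[of 0] by linarith
  have "\<bar>integral {0..2*pi} (\<lambda>x. u x * h x)\<bar> \<le> 7 * b"
    if "continuous_on {0..2*pi} h" "\<And>x. \<bar>h x\<bar> \<le> 1" for h :: "real \<Rightarrow> real"
  proof -
    have "\<bar>u x * h x\<bar> \<le> b" for x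
      using mult_mono[OF b[of x] that(2)[of x]] b0 by (simp add: abs_mult)
    then have "norm (integral {0..2*pi} (\<lambda>x. u x * h x)) \<le> integral {0..2*pi} (\<lambda>x. b)"
      by (intro integral_norm_bound_integral integrable_continuous_interval continuous_intros co that) auto
    also have "\<dots> = 2 * pi * b" by simp
    also have "\<dots> \<le> 7 * b" using b0 pi_approx by (intro mult_right_mono) auto
    finally show ?thesis by simp
  qed
  from this[of "\<lambda>x. cos (real m * x)"] this[of "\<lambda>x. sin (real m * x)"]
  have "\<bar>fourier_cos m u\<bar> \<le> 7 * b" "\<bar>fourier_sin m u\<bar> \<le> 7 * b"
    unfolding fourier_cos_def fourier_sin_def by (simp_all add: continuous_intros)
  then have "(fourier_cos m u)\<^sup>2 \<le> (7 * b)\<^sup>2" "(fourier_sin m u)\<^sup>2 \<le> (7 * b)\<^sup>2"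
    using b0 by (simp_all only: abs_le_square_iff[symmetric])
  then show ?thesis by (simp add: mode_power_def)
qed

text \<open>If the amplitude \<open>R\<close> of the nearby cosine were at most the error \<open>8 s\<close>, then \<open>\<bar>u\<bar> \<le> 16 s\<close>, and the
  power of the \<open>m\<close>-th harmonic would be at most \<open>2 (7 \<cdot> 16 s)\<^sup>2 = 25088 s\<^sup>2\<close>, where \<open>7\<close> bounds the
  length \<open>2\<pi>\<close> of the circle. The constant \<open>30000\<close> leaves room above this.\<close>

lemma alternates_if_dominant_mode:
  assumes u: "hedgehog u" and m: "m > 0" and pos: "mode_power m u > 0"
    and e: "30000 * energy (\<lambda>x. (real m)\<^sup>2 * u x + deriv (deriv u) x) \<le> mode_power m u"
  shows "alternates (2 * m) u"
proof -
  define s where "s = sqrt (mode_power m u / 30000)"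
  have s: "s > 0" "s\<^sup>2 = mode_power m u / 30000" using pos by (auto simp: s_def)
  obtain R \<theta> where near: "\<And>x. \<bar>u x - R * cos (real m * x - \<theta>)\<bar> \<le> 8 * s"
    using near_harmonic[OF u m s(1)] e s(2) by auto
  show ?thesis
  proof (rule near_harmonic_alternates[OF m _ near])
    show "\<bar>R\<bar> > 8 * s"
    proof (rule ccontr)
      assume "\<not> \<bar>R\<bar> > 8 * s"
      then have R: "\<bar>R\<bar> \<le> 8 * s" by simp
      have "\<bar>u x\<bar> \<le> 16 * s" for x
      proof -
        have "\<bar>R * cos (real m * x - \<theta>)\<bar> \<le> 8 * s * 1"
          unfolding abs_mult using R s by (intro mult_mono) auto
        then show ?thesis using near[of x] by linarith
      qed
      then have "mode_power m u \<le> 2 * (7 * (16 * s))\<^sup>2"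
        by (rule mode_power_le[OF hedgehog_continuous[OF u]])
      also have "\<dots> = 25088 * s\<^sup>2" by (simp add: power_mult_distrib)
      finally show False using s(2) pos by simp
    qed
  qed
qed

text \<open>In the grid \<open>v n j = (D + c)\<^sup>n G\<^sup>j f\<close> the operator \<open>D + c\<close> increases \<open>n\<close> and \<open>k\<^sup>2 - D\<^sup>2\<close> decreases \<open>j\<close>. The
  energy identity compares \<open>v n n\<close> with \<open>v (n + 1) (n + 1)\<close> through \<open>u = v n (n + 1)\<close>; this \<open>u\<close> is
  eventually dominated by its \<open>m\<close>-th harmonic, and its sign changes survive the way down from
  \<open>j = n + 1\<close> to \<open>j = 0\<close>.\<close>

lemma eventually_alternates:
  assumes f: "hedgehog f" and m: "m > 0" and pos: "mode_power m f > 0"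
  shows "\<forall>\<^sub>F n in sequentially. alternates (2 * m) ((damped_deriv c ^^ n) f)"
proof -
  define w where "w = c\<^sup>2 + (real m)\<^sup>2"
  define k where "k = sqrt (w + c\<^sup>2)"
  have w: "w > 0" using m by (simp add: w_def add_nonneg_pos)
  have k2: "k\<^sup>2 = w + c\<^sup>2" using w by (simp add: k_def)
  have k: "k \<noteq> 0" using w by (simp add: k_def add_pos_nonneg less_imp_neq[symmetric])
  obtain r where r: "r 0 = f" "\<And>j. hedgehog (r j)" "\<And>j. helmholtz k (r (Suc j)) = r j"
  proof -
    have "\<exists>u. hedgehog u \<and> helmholtz k u = g" if "hedgehog g" for g
      using helmholtz_surj[OF that k] by blast
    then obtain G where G: "\<And>g. hedgehog g \<Longrightarrow> hedgehog (G g) \<and> helmholtz k (G g) = g"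
      by metis
    have h: "hedgehog ((G ^^ j) f)" for j by (induction j) (auto simp: f G)
    show ?thesis by (rule that[of "\<lambda>j. (G ^^ j) f"]) (auto simp: h G)
  qed
  define v where "v n j = (damped_deriv c ^^ n) (r j)" for n j
  have v: "hedgehog (v n j)" "damped_deriv c (v n j) = v (Suc n) j" "helmholtz k (v n (Suc j)) = v n j" for n j
    using r by (auto simp: v_def hedgehog_damped_deriv_funpow
        helmholtz_damped_deriv_funpow_commute[symmetric])
  \<comment> \<open>The energy along the diagonal of the grid, and its decrement, rescaled by the growth factor \<open>4 w\<close>.\<close>
  define E where "E n = (4 * w) ^ n * energy (v n n)" for n
  define d where "d n = (4 * w) ^ n *
    energy (\<lambda>x. (real m)\<^sup>2 * v n (Suc n) x + deriv (deriv (v n (Suc n))) x)" for n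
  have E: "E n = E (Suc n) + d n" for n
    using energy_identity[OF v(1)[of n "Suc n"] w_def k2]
    by (simp add: v(2,3) E_def d_def algebra_simps)
  have d0: "0 \<le> d n" and E0: "0 \<le> E n" for n
    using w by (simp_all add: d_def E_def energy_nonneg)
  have "decseq E" using E d0 by (intro decseq_SucI) (metis le_add_same_cancel1)
  then obtain L where L: "E \<longlonglongrightarrow> L"
    using decseq_convergent[of E 0] E0 by blast
  have "(\<lambda>n. E n - E (Suc n)) \<longlonglongrightarrow> L - L"
    by (intro tendsto_diff L LIMSEQ_Suc)
  moreover have "E n - E (Suc n) = d n" for n using E[of n] by linarith
  ultimately have d: "d \<longlonglongrightarrow> 0" by simp
  have P: "mode_power m (v n n) = (2 * w)\<^sup>2 * mode_power m (v n (Suc n))"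
     "mode_power m (v (Suc n) j) = w * mode_power m (v n j)" for n j
  proof -
    show "mode_power m (v n n) = (2 * w)\<^sup>2 * mode_power m (v n (Suc n))"
      using mode_power_helmholtz[OF v(1)[of n "Suc n"], of m k] by (simp add: v(3) k2 w_def)
    show "mode_power m (v (Suc n) j) = w * mode_power m (v n j)"
      using mode_power_damped_deriv[OF v(1)[of n j], of m c] by (simp add: v(2) w_def)
  qed
  \<comment> \<open>The rescaling by \<open>4 w\<close> is exactly the one that preserves the \<open>m\<close>-th harmonic.\<close>
  have Pn: "(4 * w) ^ n * mode_power m (v n n) = mode_power m f" for n
  proof (induction n)
    case 0
    then show ?case by (simp add: v_def r)
  next
    case (Suc n)
    have "(4 * w) ^ Suc n * mode_power m (v (Suc n) (Suc n)) = (4 * w) ^ n * mode_power m (v n n)"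
      by (simp only: P(1)[of n] P(2)[of n "Suc n"]) (simp add: power2_eq_square)
    then show ?case using Suc by (simp only:)
  qed
  define \<kappa> where "\<kappa> = mode_power m f / (2 * w)\<^sup>2"
  have \<kappa>: "\<kappa> > 0" "(4 * w) ^ n * mode_power m (v n (Suc n)) = \<kappa>" for n
    using Pn[of n] P(1)[of n] pos w by (auto simp: \<kappa>_def field_simps)
  have "\<forall>\<^sub>F n in sequentially. d n < \<kappa> / 30000"
    by (rule order_tendstoD(2)[OF d]) (use \<kappa>(1) in simp)
  then show ?thesis
  proof eventually_elim
    case (elim n)
    have p: "(4 * w) ^ n > 0" using w by simp
    have "alternates (2 * m) (v n (Suc n))"
    proof (rule alternates_if_dominant_mode[OF v(1) m])
      show "mode_power m (v n (Suc n)) > 0"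
        by (rule zero_less_mult_pos[OF _ p]) (simp only: \<kappa>)
      have "(4 * w) ^ n * (30000 * energy (\<lambda>x. (real m)\<^sup>2 * v n (Suc n) x + deriv (deriv (v n (Suc n))) x))
          = 30000 * d n"
        by (simp add: d_def)
      also have "\<dots> \<le> (4 * w) ^ n * mode_power m (v n (Suc n))"
        using elim by (simp only: \<kappa>(2))
      finally have "(4 * w) ^ n * (30000 * energy (\<lambda>x. (real m)\<^sup>2 * v n (Suc n) x + deriv (deriv (v n (Suc n))) x))
          \<le> (4 * w) ^ n * mode_power m (v n (Suc n))" .
      then show "30000 * energy (\<lambda>x. (real m)\<^sup>2 * v n (Suc n) x + deriv (deriv (v n (Suc n))) x)
          \<le> mode_power m (v n (Suc n))"
        using p by (simp only: mult_le_cancel_left_pos)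
    qed
    moreover have "alternates (2 * m) (v n 0)" if "alternates (2 * m) (v n j)" for j
      using that
    proof (induction j)
      case (Suc j)
      then show ?case using alternates_helmholtz[OF v(1)[of n "Suc j"], of "2 * m" k] v(3) by simp
    qed
    ultimately have "alternates (2 * m) (v n 0)" by blast
    then show ?case by (simp add: v_def r)
  qed
qed

section \<open>Iterated skew evolutes\<close>

lemma deriv_scaled_shift:
  assumes "hedgehog f"
  shows "deriv (\<lambda>x. s * f (x - b)) = (\<lambda>x. s * deriv f (x - b))"
proof
  fix x
  have "((\<lambda>x. f (x + (- b))) has_real_derivative deriv f (x + (- b))) (at x)"
    using hedgehog_DERIV[OF assms] DERIV_shift by blast
  then show "deriv (\<lambda>x. s * f (x - b)) x = s * deriv f (x - b)"
    by (intro DERIV_imp_deriv DERIV_cmult) simp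
qed

lemma skew_evolute_scaled_shift:
  assumes "hedgehog f" "sin \<alpha> \<noteq> 0"
  shows "skew_evolute \<alpha> (\<lambda>x. s * f (x - b)) =
    (\<lambda>x. (s * sin \<alpha>) * damped_deriv (cot \<alpha>) f (x - (b + \<alpha>)))"
  using assms(2)
  by (simp add: skew_evolute_def deriv_scaled_shift[OF assms(1)] damped_deriv_def cot_def
      fun_eq_iff field_simps)

lemma skew_evolute_funpow:
  assumes "hedgehog p" "sin \<alpha> \<noteq> 0"
  shows "(skew_evolute \<alpha> ^^ n) p =
    (\<lambda>x. sin \<alpha> ^ n * (damped_deriv (cot \<alpha>) ^^ n) p (x - real n * \<alpha>))"
proof (induction n)
  case (Suc n)
  have "(skew_evolute \<alpha> ^^ Suc n) p =
      skew_evolute \<alpha> (\<lambda>x. sin \<alpha> ^ n * (damped_deriv (cot \<alpha>) ^^ n) p (x - real n * \<alpha>))"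
    using Suc by simp
  then show ?case
    by (simp add: skew_evolute_scaled_shift hedgehog_damped_deriv_funpow assms algebra_simps)
qed simp

lemma curvature_radius_eq: "curvature_radius p = (\<lambda>x. 1 * p x + 1 * deriv (deriv p) x)"
  by (simp add: fun_eq_iff curvature_radius_def)

lemma hedgehog_curvature_radius: "hedgehog p \<Longrightarrow> hedgehog (curvature_radius p)"
  unfolding curvature_radius_eq by (intro hedgehog_linear_combination hedgehog_deriv)

lemma curvature_radius_damped_deriv_funpow:
  assumes "hedgehog p"
  shows "curvature_radius ((damped_deriv c ^^ n) p) = (damped_deriv c ^^ n) (curvature_radius p)"
proof (induction n)
  case (Suc n)
  have "curvature_radius (damped_deriv c u) = damped_deriv c (curvature_radius u)" if "hedgehog u" for u
    unfolding curvature_radius_eq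
    by (simp only: damped_deriv_linear_combination deriv_damped_deriv hedgehog_deriv that)
  then show ?case using Suc by (simp add: hedgehog_damped_deriv_funpow assms)
qed simp

lemma curvature_radius_scaled_shift:
  assumes "hedgehog f"
  shows "curvature_radius (\<lambda>x. s * f (x - b)) = (\<lambda>x. s * curvature_radius f (x - b))"
  by (simp add: fun_eq_iff curvature_radius_def deriv_scaled_shift hedgehog_deriv assms algebra_simps)

lemma curvature_radius_skew_evolute_funpow:
  assumes "hedgehog p" "sin \<alpha> \<noteq> 0"
  shows "curvature_radius ((skew_evolute \<alpha> ^^ n) p) =
    (\<lambda>x. sin \<alpha> ^ n * (damped_deriv (cot \<alpha>) ^^ n) (curvature_radius p) (x - real n * \<alpha>))"
  by (simp add: skew_evolute_funpow curvature_radius_scaled_shift hedgehog_damped_deriv_funpow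
      curvature_radius_damped_deriv_funpow assms)

text \<open>The curvature radius \<open>p + p''\<close> has the multiplier \<open>1 - m\<^sup>2\<close> on the \<open>m\<close>-th harmonic. It loses only the
  harmonics \<open>m = 1\<close>, which describe translations.\<close>

lemma eventually_num_cusps_ge:
  assumes p: "hedgehog p" and \<alpha>: "sin \<alpha> \<noteq> 0" and m: "m > 1" and pos: "mode_power m p \<noteq> 0"
  shows "\<forall>\<^sub>F n in sequentially. enat (2 * m) \<le> num_cusps ((skew_evolute \<alpha> ^^ n) p)"
proof -
  have "mode_power m (curvature_radius p) = (1 - (real m)\<^sup>2)\<^sup>2 * mode_power m p"
    unfolding curvature_radius_eq using mode_power_second_order[OF p, of m 1 1] by simp
  moreover have "(1 - (real m)\<^sup>2)\<^sup>2 > 0" using m by (simp add: power2_eq_1_iff)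
  moreover have "mode_power m p > 0" using pos by (simp add: mode_power_def add_nonneg_eq_0_iff less_le)
  ultimately have "mode_power m (curvature_radius p) > 0" by simp
  from eventually_alternates[OF hedgehog_curvature_radius[OF p] _ this] m
  have "\<forall>\<^sub>F n in sequentially.
      alternates (2 * m) ((damped_deriv (cot \<alpha>) ^^ n) (curvature_radius p))" by simp
  then show ?thesis
  proof eventually_elim
    case (elim n)
    let ?g = "(damped_deriv (cot \<alpha>) ^^ n) (curvature_radius p)"
    have g: "hedgehog ?g" by (intro hedgehog_damped_deriv_funpow hedgehog_curvature_radius p)
    have "?g (x + 2 * pi - real n * \<alpha>) = ?g (x - real n * \<alpha>)" for x
      using hedgehog_periodic[OF g, of "x - real n * \<alpha>"] by (simp add: algebra_simps)
    then show ?case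
      using alternates_scaled_shift[OF elim] \<alpha>
      by (intro num_cusps_ge_alternations)
        (auto simp: curvature_radius_skew_evolute_funpow[OF p \<alpha>]
          intro!: continuous_intros continuous_on_compose2[OF hedgehog_continuous[OF g, of UNIV]])
  qed
qed

theorem theorem2:
  fixes \<alpha> :: real and p :: "real \<Rightarrow> real"
  assumes "sin \<alpha> \<noteq> 0"
    and "hedgehog p"
    and "\<not> trig_polynomial p"
  shows "(\<lambda>n. num_cusps ((skew_evolute \<alpha> ^^ n) p)) \<longlonglongrightarrow> \<infinity>"
proof (rule order_tendstoI)
  fix a :: enat assume "a < \<infinity>"
  then obtain K where K: "a = enat K" by (cases a) auto
  obtain m where m: "m > K + 1" "fourier_cos m p \<noteq> 0 \<or> fourier_sin m p \<noteq> 0"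
    using trig_polynomial_if_high_coeffs_0[OF assms(2), of "K + 1"] assms(3) by blast
  then have "mode_power m p \<noteq> 0" by (simp add: mode_power_def sum_power2_eq_zero_iff)
  with m have "\<forall>\<^sub>F n in sequentially. enat (2 * m) \<le> num_cusps ((skew_evolute \<alpha> ^^ n) p)"
    by (intro eventually_num_cusps_ge assms) auto
  then show "\<forall>\<^sub>F n in sequentially. a < num_cusps ((skew_evolute \<alpha> ^^ n) p)"
  proof eventually_elim
    case (elim n)
    have "a < enat (2 * m)" using m by (simp add: K)
    then show ?case using elim by (rule less_le_trans)
  qed
qed auto

end
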